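(* Let $n\in\mathbb{N}$, $\theta\in\,]0,1]$, $\lambda>0$, and let $$\mathcal{V}_n=\underset{f\in\mathcal{M}^+_{\mathrm{D}\otimes\mathrm{D},0}(\mathcal{X}_n)}{\operatorname{argmin}}\big(E(\mathbf{y},\langle f,\boldsymbol{\nu}\rangle)+\lambda\|f\|_\theta\big),\qquad \tilde{\mathcal{V}}_n=\underset{\mathbf{a}\in\mathbb{R}_+^{2^n\times2^n}}{\operatorname{argmin}}\big(E(\mathbf{y},\langle \mathrm{T}^\star\{\mathbf{a}\},\boldsymbol{\nu}\rangle)+\lambda\|\mathbf{a}\|_\theta\big).$$ These two optimization problems are equivalent, in the sense that, for $f\in\mathcal{M}^+_{\mathrm{D}\otimes\mathrm{D},0}(\mathcal{X}_n)$, $$f\in\mathcal{V}_n\iff \mathrm{T}\{f\}\in\tilde{\mathcal{V}}_n.$$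
   Context: $\mathrm{K}=[0,1]^2$ and $\mathrm{K}^c=\mathbb{R}^2\setminus\mathrm{K}$. Derivatives are in the sense of distributions: for $f\in\mathcal{D}'(\mathbb{R}^2)$, $[\mathrm{D}\otimes\mathrm{I}]\{f\}=\partial_{x_1}f$, $[\mathrm{I}\otimes\mathrm{D}]\{f\}=\partial_{x_2}f$, $[\mathrm{D}\otimes\mathrm{D}]\{f\}=\partial_{x_1}\partial_{x_2}f$. $\mathcal{M}(\mathrm{K})$ is the space of bounded (finite signed) Borel measures on $\mathbb{R}^2$ supported in $\mathrm{K}$, with total variation norm $\|\cdot\|_{\mathcal{M}}$. Define $$\mathcal{M}_{\mathrm{D}\otimes\mathrm{D},0}(\mathrm{K})=\{f\in\mathcal{D}'(\mathbb{R}^2):\ [\mathrm{D}\otimes\mathrm{D}]\{f\}\in\mathcal{M}(\mathrm{K})\ \text{and}\ \langle f,\phi\rangle=0\ \ \forall\phi\in\mathcal{C}_c^\infty(\mathrm{K}^c)\},$$ $$\|\nabla\{f\}\|_{\mathcal{M}^2}=\|[\mathrm{I}\otimes\mathrm{D}]\{f\}\|_{\mathcal{M}}+\|[\mathrm{D}\otimes\mathrm{I}]\{f\}\|_{\mathcal{M}},$$ $$\|f\|_\theta=\theta\,\|[\mathrm{D}\otimes\mathrm{D}]\{f\}\|_{\mathcal{M}}+(1-\theta)\,\|\nabla\{f\}\|_{\mathcal{M}^2}.$$ The convex cone of positive functions is $\mathcal{M}^+_{\mathrm{D}\otimes\mathrm{D},0}(\mathrm{K})=\{f\in\mathcal{M}_{\mathrm{D}\otimes\mathrm{D},0}(\mathrm{K}):\forall\phi\in\mathcal{C}_c^\infty(\mathbb{R}^2),\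 \phi\ge0\Rightarrow\langle f,\phi\rangle\ge0\}$. Data: $\mathbf{y}\in\mathbb{R}^M$; $E:\mathbb{R}^M\times\mathbb{R}^M\to\mathbb{R}^+\cup\{\infty\}$ is proper, coercive, continuous, and strictly convex in its second argument; $\langle\cdot,\boldsymbol{\nu}\rangle:\mathcal{M}^+_{\mathrm{D}\otimes\mathrm{D},0}(\mathrm{K})\to\mathbb{R}^M$ is linear and weak$^\star$ continuous, where the weak$^\star$ topology is the coarsest one making all maps $f\mapsto\int\phi\,\mathrm{d}([\mathrm{D}\otimes\mathrm{D}]\{f\})$, $\phi\in\mathcal{C}_0(\mathbb{R}^2)$, continuous. Discretization: the grid is $\mathcal{X}_n=2^{-n}\{0,\dots,2^n\}\times2^{-n}\{0,\dots,2^n\}$, with $(2^n+1)^2$ knots, and pixels $E^n_{n_1,n_2}=\big[\tfrac{n_1-1}{2^n},\tfrac{n_1}{2^n}\big]\times\big[\tfrac{n_2-1}{2^n},\tfrac{n_2}{2^n}\big]$, $1\le n_1,n_2\le2^n$. The discretized search space is $\mathcal{M}^+_{\mathrm{D}\otimes\mathrm{D},0}(\mathcal{X}_n)=\{f\in\mathcal{M}^+_{\mathrm{D}\otimes\mathrm{D},0}(\mathrm{K}):[\mathrm{D}\otimes\mathrm{D}]\{f\}\in\mathcal{M}(\mathcal{X}_n)\}$, where $\mathcal{M}(\mathcal{X}_n)$ is the set of measures supported on $\mathcal{X}_n$. With $\mathbb{R}_+=[0,\infty[$, the operators $\mathrm{T}:\mathcal{M}^+_{\mathrm{D}\otimes\mathrm{D},0}(\mathcal{X}_n)\to\mathbb{R}_+^{2^n\times2^n}$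 and $\mathrm{T}^\star:\mathbb{R}_+^{2^n\times2^n}\to\mathcal{M}^+_{\mathrm{D}\otimes\mathrm{D},0}(\mathcal{X}_n)$ are $$\mathrm{T}\{f\}=\big(2^{2n}\langle f,\mathbb{1}_{E^n_{n_1,n_2}}\rangle\big)_{n_1,n_2=1}^{2^n},\qquad \mathrm{T}^\star\{\mathbf{a}\}=\sum_{n_1,n_2=1}^{2^n}a_{n_1,n_2}\mathbb{1}_{E^n_{n_1,n_2}}.$$ For $\mathbf{a}\in\mathbb{R}_+^{2^n\times2^n}$, extended by $0$ to a sequence on $\mathbb{Z}^2$, $$\|\mathbf{a}\|_\theta=(1-\theta)2^{-n}\big(\|\boldsymbol{h}_{1,0}\ast\mathbf{a}\|_{\ell_1}+\|\boldsymbol{h}_{0,1}\ast\mathbf{a}\|_{\ell_1}\big)+\theta\|\boldsymbol{h}_{1,1}\ast\mathbf{a}\|_{\ell_1},$$ with discrete convolution on $\mathbb{Z}^2$ and finite filters $\boldsymbol{h}_{1,1}=\begin{bmatrix}1&-1\\-1&1\end{bmatrix}$, $\boldsymbol{h}_{1,0}=\begin{bmatrix}1\\-1\end{bmatrix}$, $\boldsymbol{h}_{0,1}=\begin{bmatrix}1&-1\end{bmatrix}$ (first index $n_1$ = row, second index $n_2$ = column; the placement of the filter origin does not affect the $\ell_1$ norms). *)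

theory Defs
  imports "HOL-Analysis.Analysis"
begin

type_synonym plane = "real \<times> real"

type_synonym functional = "(plane \<Rightarrow> real) \<Rightarrow> real"

definition partial1 :: "(plane \<Rightarrow> real) \<Rightarrow> plane \<Rightarrow> real" where
  "partial1 \<phi> x = frechet_derivative \<phi> (at x) (1, 0)"

definition partial2 :: "(plane \<Rightarrow> real) \<Rightarrow> plane \<Rightarrow> real" where
  "partial2 \<phi> x = frechet_derivative \<phi> (at x) (0, 1)"

fun C_k :: "nat \<Rightarrow> (plane \<Rightarrow> real) \<Rightarrow> bool" where
  "C_k 0 \<phi> \<longleftrightarrow> continuous_on UNIV \<phi>"
| "C_k (Suc k) \<phi> \<longleftrightarrow> \<phi> differentiable_on UNIV \<and> C_k k (partial1 \<phi>) \<and> C_k k (partial2 \<phi>)"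

definition tsupport :: "(plane \<Rightarrow> real) \<Rightarrow> plane set" where
  "tsupport \<phi> = closure {x. \<phi> x \<noteq> 0}"

definition test_functions :: "plane set \<Rightarrow> (plane \<Rightarrow> real) set" where
  "test_functions \<Omega> = {\<phi>. (\<forall>k. C_k k \<phi>) \<and> compact (tsupport \<phi>) \<and> tsupport \<phi> \<subseteq> \<Omega>}"

text \<open>
  A distribution is a linear functional on the test functions with the usual seminorm estimate on
  each compact set. It is represented by its extension by zero to all functions, so that two
  distributions are equal iff they agree on the test functions.
\<close>

definition distributions :: "functional set" where
  "distributions = {f.
     (\<forall>\<phi>. \<phi> \<notin> test_functions UNIV \<longrightarrow> f \<phi> = 0) \<and>
     (\<forall>\<phi>\<in>test_functions UNIV. \<forall>\<psi>\<in>test_functions UNIV. \<forall>a b.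
        f (\<lambda>x. a * \<phi> x + b * \<psi> x) = a * f \<phi> + b * f \<psi>) \<and>
     (\<forall>L. compact L \<longrightarrow> (\<exists>C N. \<forall>\<phi>\<in>test_functions UNIV. tsupport \<phi> \<subseteq> L \<longrightarrow>
        \<bar>f \<phi>\<bar> \<le> C * (\<Sum>i\<le>N. \<Sum>j\<le>N. SUP x. \<bar>(partial1 ^^ i) ((partial2 ^^ j) \<phi>) x\<bar>)))}"

text \<open>\<open>D_I\<close>, \<open>I_D\<close> and \<open>D_D\<close> are the operators $D \otimes I$, $I \otimes D$ and $D \otimes D$.\<close>

definition D_I :: "functional \<Rightarrow> functional" where
  "D_I f = (\<lambda>\<phi>. if \<phi> \<in> test_functions UNIV then - f (partial1 \<phi>) else 0)"

definition I_D :: "functional \<Rightarrow> functional" where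
  "I_D f = (\<lambda>\<phi>. if \<phi> \<in> test_functions UNIV then - f (partial2 \<phi>) else 0)"

definition D_D :: "functional \<Rightarrow> functional" where
  "D_D f = D_I (I_D f)"

definition locally_integrable :: "(plane \<Rightarrow> real) \<Rightarrow> bool" where
  "locally_integrable u \<longleftrightarrow> (\<forall>L. compact L \<longrightarrow> set_integrable lborel L u)"

definition dist_of_fun :: "(plane \<Rightarrow> real) \<Rightarrow> functional" where
  "dist_of_fun u = (\<lambda>\<phi>. if \<phi> \<in> test_functions UNIV then LINT x|lborel. u x * \<phi> x else 0)"

text \<open>
  The pairing of a distribution with an arbitrary function, such as the indicator of a pixel, is
  meaningful if the distribution is given by a locally integrable function, which is then unique
  almost everywhere.
\<close>

definition fun_of_dist :: "functional \<Rightarrow> plane \<Rightarrow> real" where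
  "fun_of_dist f = (SOME u. locally_integrable u \<and> dist_of_fun u = f)"

definition pairing :: "functional \<Rightarrow> (plane \<Rightarrow> real) \<Rightarrow> real" where
  "pairing f g = (LINT x|lborel. fun_of_dist f x * g x)"

text \<open>
  Signed measures are extended by zero to the non-Borel sets. The convergence in \<open>sums\<close> for
  the constant sequence of empty sets forces \<open>\<mu> {} = 0\<close>.
\<close>

definition signed_measure :: "(plane set \<Rightarrow> real) \<Rightarrow> bool" where
  "signed_measure \<mu> \<longleftrightarrow>
     (\<forall>A. A \<notin> sets borel \<longrightarrow> \<mu> A = 0) \<and>
     (\<forall>A :: nat \<Rightarrow> plane set. range A \<subseteq> sets borel \<longrightarrow> disjoint_family A \<longrightarrow>
        (\<lambda>i. \<mu> (A i)) sums \<mu> (\<Union>i. A i))"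

text \<open>
  Upper and lower variation, i.e. the two parts of the Jordan decomposition. In the first
  definition \<open>ennreal\<close> truncates negative values to 0, which does not change the
  supremum since the empty set is among the sets \<open>B\<close>.
\<close>

definition upper_variation :: "(plane set \<Rightarrow> real) \<Rightarrow> plane measure" where
  "upper_variation \<mu> =
     measure_of UNIV (sets borel) (\<lambda>A. SUP B\<in>{B \<in> sets borel. B \<subseteq> A}. ennreal (\<mu> B))"

definition lower_variation :: "(plane set \<Rightarrow> real) \<Rightarrow> plane measure" where
  "lower_variation \<mu> = upper_variation (\<lambda>A. - \<mu> A)"

definition total_variation :: "(plane set \<Rightarrow> real) \<Rightarrow> ennreal" where
  "total_variation \<mu> = emeasure (upper_variation \<mu>) UNIV + emeasure (lower_variation \<mu>) UNIV"

definition signed_integral :: "(plane set \<Rightarrow> real) \<Rightarrow> (plane \<Rightarrow> real) \<Rightarrow> real" where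
  "signed_integral \<mu> \<phi> =
     (LINT x|upper_variation \<mu>. \<phi> x) - (LINT x|lower_variation \<mu>. \<phi> x)"

definition supported_in :: "plane set \<Rightarrow> (plane set \<Rightarrow> real) \<Rightarrow> bool" where
  "supported_in S \<mu> \<longleftrightarrow> (\<forall>A\<in>sets borel. A \<inter> S = {} \<longrightarrow> \<mu> A = 0)"

definition dist_of_measure :: "(plane set \<Rightarrow> real) \<Rightarrow> functional" where
  "dist_of_measure \<mu> = (\<lambda>\<phi>. if \<phi> \<in> test_functions UNIV then signed_integral \<mu> \<phi> else 0)"

text \<open>\<open>measures_in S\<close> is $\mathcal{M}(S)$ for closed \<open>S\<close>, as a set of distributions.\<close>

definition measures_in :: "plane set \<Rightarrow> functional set" where
  "measures_in S = dist_of_measure ` {\<mu>. signed_measure \<mu> \<and> supported_in S \<mu>}"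

definition measure_of_dist :: "functional \<Rightarrow> plane set \<Rightarrow> real" where
  "measure_of_dist g = (THE \<mu>. signed_measure \<mu> \<and> dist_of_measure \<mu> = g)"

text \<open>The total variation norm, with value \<open>\<infinity>\<close> for distributions that are not finite measures.\<close>

definition M_norm :: "functional \<Rightarrow> ennreal" where
  "M_norm g = (if g \<in> measures_in UNIV then total_variation (measure_of_dist g) else \<infinity>)"

definition unit_square :: "plane set" where
  "unit_square = {0..1} \<times> {0..1}"

definition M_DD0 :: "functional set" where
  "M_DD0 = {f \<in> distributions. D_D f \<in> measures_in unit_square \<and> (\<forall>\<phi>\<in>test_functions (- unit_square). f \<phi> = 0)}"

definition M_DD0_pos :: "functional set" where
  "M_DD0_pos = {f \<in> M_DD0. \<forall>\<phi>\<in>test_functions UNIV. (\<forall>x. \<phi> x \<ge> 0) \<longrightarrow> f \<phi> \<ge> 0}"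

definition grad_norm :: "functional \<Rightarrow> ennreal" where
  "grad_norm f = M_norm (I_D f) + M_norm (D_I f)"

definition theta_norm :: "real \<Rightarrow> functional \<Rightarrow> ennreal" where
  "theta_norm \<theta> f = ennreal \<theta> * M_norm (D_D f) + ennreal (1 - \<theta>) * grad_norm f"

definition C_0 :: "(plane \<Rightarrow> real) set" where
  "C_0 = {\<phi>. continuous_on UNIV \<phi> \<and> (\<phi> \<longlongrightarrow> 0) at_infinity}"

definition weak_star_topology :: "functional topology" where
  "weak_star_topology = topology_generated_by
     {{f \<in> M_DD0. signed_integral (measure_of_dist (D_D f)) \<phi> \<in> U} | \<phi> U. \<phi> \<in> C_0 \<and> open U}"

definition linear_on_cone :: "(functional \<Rightarrow> real ^ 'm) \<Rightarrow> bool" where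
  "linear_on_cone \<nu> \<longleftrightarrow> (\<forall>f\<in>M_DD0_pos. \<forall>g\<in>M_DD0_pos. \<forall>a\<ge>0. \<forall>b\<ge>0.
     \<nu> (\<lambda>\<phi>. a * f \<phi> + b * g \<phi>) = a *\<^sub>R \<nu> f + b *\<^sub>R \<nu> g)"

definition weak_star_continuous :: "(functional \<Rightarrow> real ^ 'm) \<Rightarrow> bool" where
  "weak_star_continuous \<nu> \<longleftrightarrow>
     continuous_map (subtopology weak_star_topology M_DD0_pos) euclidean \<nu>"

definition proper :: "('a \<Rightarrow> ennreal) \<Rightarrow> bool" where
  "proper F \<longleftrightarrow> (\<exists>z. F z \<noteq> \<infinity>)"

definition coercive :: "('a::real_normed_vector \<Rightarrow> ennreal) \<Rightarrow> bool" where
  "coercive F \<longleftrightarrow> (F \<longlongrightarrow> \<infinity>) at_infinity"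

text \<open>For extended-valued functions the strict inequality is required on the effective domain.\<close>

definition strictly_convex :: "('a::real_vector \<Rightarrow> ennreal) \<Rightarrow> bool" where
  "strictly_convex F \<longleftrightarrow> (\<forall>z w t. z \<noteq> w \<longrightarrow> F z \<noteq> \<infinity> \<longrightarrow> F w \<noteq> \<infinity> \<longrightarrow> 0 < t \<longrightarrow> t < 1 \<longrightarrow>
     F ((1 - t) *\<^sub>R z + t *\<^sub>R w) < ennreal (1 - t) * F z + ennreal t * F w)"

definition grid :: "nat \<Rightarrow> plane set" where
  "grid n = {(real i / 2 ^ n, real j / 2 ^ n) | i j. i \<le> 2 ^ n \<and> j \<le> 2 ^ n}"

definition M_DD0_pos_grid :: "nat \<Rightarrow> functional set" where
  "M_DD0_pos_grid n = {f \<in> M_DD0_pos. D_D f \<in> measures_in (grid n)}"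

definition pixel :: "nat \<Rightarrow> int \<times> int \<Rightarrow> plane set" where
  "pixel n k = {of_int (fst k - 1) / 2 ^ n .. of_int (fst k) / 2 ^ n} \<times>
               {of_int (snd k - 1) / 2 ^ n .. of_int (snd k) / 2 ^ n}"

definition indices :: "nat \<Rightarrow> (int \<times> int) set" where
  "indices n = {1..2 ^ n} \<times> {1..2 ^ n}"

text \<open>Matrices indexed by \<open>indices n\<close> are represented by their extension by zero.\<close>

definition nonneg_matrices :: "nat \<Rightarrow> (int \<times> int \<Rightarrow> real) set" where
  "nonneg_matrices n = {a. (\<forall>k\<in>indices n. a k \<ge> 0) \<and> (\<forall>k. k \<notin> indices n \<longrightarrow> a k = 0)}"

definition T_op :: "nat \<Rightarrow> functional \<Rightarrow> int \<times> int \<Rightarrow> real" where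
  "T_op n f = (\<lambda>k. if k \<in> indices n then 2 ^ (2 * n) * pairing f (indicator (pixel n k)) else 0)"

definition T_star :: "nat \<Rightarrow> (int \<times> int \<Rightarrow> real) \<Rightarrow> functional" where
  "T_star n a = dist_of_fun (\<lambda>x. \<Sum>k\<in>indices n. a k * indicator (pixel n k) x)"

definition h11 :: "int \<times> int \<Rightarrow> real" where
  "h11 k = (if k = (0, 0) \<or> k = (1, 1) then 1 else if k = (0, 1) \<or> k = (1, 0) then -1 else 0)"

definition h10 :: "int \<times> int \<Rightarrow> real" where
  "h10 k = (if k = (0, 0) then 1 else if k = (1, 0) then -1 else 0)"

definition h01 :: "int \<times> int \<Rightarrow> real" where
  "h01 k = (if k = (0, 0) then 1 else if k = (0, 1) then -1 else 0)"

definition conv :: "(int \<times> int \<Rightarrow> real) \<Rightarrow> (int \<times> int \<Rightarrow> real) \<Rightarrow> int \<times> int \<Rightarrow> real" where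
  "conv h a k = (\<Sum>\<^sub>\<infinity>j. h j * a (k - j))"

definition l1_norm :: "(int \<times> int \<Rightarrow> real) \<Rightarrow> real" where
  "l1_norm a = (\<Sum>\<^sub>\<infinity>k. \<bar>a k\<bar>)"

definition discrete_theta_norm :: "nat \<Rightarrow> real \<Rightarrow> (int \<times> int \<Rightarrow> real) \<Rightarrow> real" where
  "discrete_theta_norm n \<theta> a =
     (1 - \<theta>) * (1 / 2 ^ n) * (l1_norm (conv h10 a) + l1_norm (conv h01 a))
     + \<theta> * l1_norm (conv h11 a)"

definition argmin_set :: "('a \<Rightarrow> ennreal) \<Rightarrow> 'a set \<Rightarrow> 'a set" where
  "argmin_set F S = {x. is_arg_min F (\<lambda>x. x \<in> S) x}"

definition V_grid :: "(real ^ 'm \<Rightarrow> real ^ 'm \<Rightarrow> ennreal) \<Rightarrow> real ^ 'm \<Rightarrow> (functional \<Rightarrow> real ^ 'm) \<Rightarrow>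
    real \<Rightarrow> real \<Rightarrow> nat \<Rightarrow> functional set" where
  "V_grid E y \<nu> \<theta> lam n =
     argmin_set (\<lambda>f. E y (\<nu> f) + ennreal lam * theta_norm \<theta> f) (M_DD0_pos_grid n)"

definition V_tilde :: "(real ^ 'm \<Rightarrow> real ^ 'm \<Rightarrow> ennreal) \<Rightarrow> real ^ 'm \<Rightarrow> (functional \<Rightarrow> real ^ 'm) \<Rightarrow>
    real \<Rightarrow> real \<Rightarrow> nat \<Rightarrow> (int \<times> int \<Rightarrow> real) set" where
  "V_tilde E y \<nu> \<theta> lam n =
     argmin_set (\<lambda>a. E y (\<nu> (T_star n a)) + ennreal (lam * discrete_theta_norm n \<theta> a))
       (nonneg_matrices n)"

end

theory Submission
  imports Defs
begin

text \<open>
  The two problems have the same objective along the map \<open>T_star n\<close>, and \<open>T_star n\<close> maps the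
  nonnegative matrices bijectively onto the discretized search space, with inverse \<open>T_op n\<close>. Since
  being a minimizer only depends on the values of the objective, this gives the equivalence.

  \<^emph>\<open>Surjectivity\<close> (\<open>grid_space_is_T_star\<close>). A distribution \<open>f\<close> that vanishes off the square is
  determined by its mixed derivative: integrating a test function \<open>\<psi>\<close> along long segments in both
  directions gives a test function whose mixed derivative is \<open>\<psi>\<close> plus translates of \<open>\<psi>\<close> that live
  off the square (\<open>D_D_recovers\<close>). If the mixed derivative consists of masses at the knots, then the
  pairing of \<open>f\<close> with a bump inside a pixel is a positive multiple of the total mass to the upper
  right of that pixel. Call these totals \<open>a\<close>. They vanish for pixels outside the square because \<open>f\<close>
  does, and they are nonnegative because \<open>f\<close> is. Their second order differences are the masses, so
  \<open>f\<close> and \<open>T_star n a\<close> have the same mixed derivative and hence agree.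

  \<^emph>\<open>Injectivity\<close> (\<open>T_op_T_star\<close>). Locally integrable functions that define the same distribution
  have the same integral over every box, because smooth bumps converge boundedly to the indicator of
  an open box. So averaging over a pixel returns the pixel value.

  \<^emph>\<open>Norms\<close> (\<open>theta_norm_T_star\<close>). By the fundamental theorem of calculus and summation by parts, the
  derivatives of a pixel image are measures on the edges and knots of the grid, weighted by the
  finite differences of the matrix. These carriers are disjoint, so the total variation is the sum
  of the absolute weights, times the edge length. The norm refers to \<^emph>\<open>the\<close> measure that represents a
  distribution; that it is unique (\<open>dist_of_measure_inject\<close>) rests on the Jordan decomposition of an
  arbitrary signed measure, and again on the approximation of boxes by bumps.
\<close>

section \<open>Calculus of \<open>C_k\<close> functions on the plane\<close>

lemma C_k_has_derivative:
  assumes "C_k (Suc k) \<phi>"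
  shows "(\<phi> has_derivative (\<lambda>h. fst h * partial1 \<phi> x + snd h * partial2 \<phi> x)) (at x)"
proof -
  let ?D = "frechet_derivative \<phi> (at x)"
  have D: "(\<phi> has_derivative ?D) (at x)"
    using assms unfolding frechet_derivative_works[symmetric]
    by (simp add: differentiable_on_def del: split_paired_All)
  then have lin: "linear ?D"
    by (rule has_derivative_linear)
  have "?D h = fst h * partial1 \<phi> x + snd h * partial2 \<phi> x" for h
  proof -
    have "h = fst h *\<^sub>R (1, 0) + snd h *\<^sub>R (0, 1)"
      by (cases h) simp
    then have "?D h = ?D (fst h *\<^sub>R (1, 0) + snd h *\<^sub>R (0, 1))"
      by (rule arg_cong)
    also have "\<dots> = fst h * partial1 \<phi> x + snd h * partial2 \<phi> x"
      unfolding partial1_def partial2_def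
      by (simp only: linear_add[OF lin] linear_scale[OF lin] real_scaleR_def)
    finally show ?thesis .
  qed
  then have "?D = (\<lambda>h. fst h * partial1 \<phi> x + snd h * partial2 \<phi> x)"
    by (rule ext)
  then show ?thesis
    using D by simp
qed

lemma partials_eqI:
  assumes "\<And>x. (\<phi> has_derivative (\<lambda>h. fst h * p x + snd h * q x)) (at x)"
  shows "partial1 \<phi> = p" "partial2 \<phi> = q"
proof -
  have "frechet_derivative \<phi> (at x) = (\<lambda>h. fst h * p x + snd h * q x)" for x
    using frechet_derivative_at[OF assms] by simp
  then show "partial1 \<phi> = p" "partial2 \<phi> = q"
    by (auto simp: partial1_def partial2_def)
qed

text \<open>
  Exhibiting the total derivative yields differentiability and the two partial derivatives at once, so
  each closure property of \<open>C_k\<close> needs a single computation.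
\<close>

lemma C_k_SucI:
  assumes "\<And>x. (\<phi> has_derivative (\<lambda>h. fst h * p x + snd h * q x)) (at x)"
    and "C_k k p" "C_k k q"
  shows "C_k (Suc k) \<phi>"
  using assms(2,3) partials_eqI[OF assms(1)]
  by (auto simp: differentiable_on_def intro: has_derivative_at_withinI differentiableI[OF assms(1)])

lemma C_k_continuous_on: "C_k k \<phi> \<Longrightarrow> continuous_on UNIV \<phi>"
  by (cases k) (auto intro: differentiable_imp_continuous_on)

lemma C_k_SucD: "C_k (Suc k) \<phi> \<Longrightarrow> C_k k \<phi>"
proof (induction k arbitrary: \<phi>)
  case 0
  then show ?case
    using C_k_continuous_on[OF 0] by simp
next
  case (Suc k)
  then show ?case
    by (metis C_k.simps(2))
qed

lemma lincomb_has_derivative: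
  assumes "C_k (Suc k) \<phi>" "C_k (Suc k) \<psi>"
  shows "((\<lambda>x. a * \<phi> x + b * \<psi> x) has_derivative
        (\<lambda>h. fst h * (a * partial1 \<phi> x + b * partial1 \<psi> x) +
             snd h * (a * partial2 \<phi> x + b * partial2 \<psi> x))) (at x)"
  by (auto intro!: derivative_eq_intros C_k_has_derivative[OF assms(1)]
        C_k_has_derivative[OF assms(2)] simp: algebra_simps)

lemma C_k_lincomb:
  "C_k k \<phi> \<Longrightarrow> C_k k \<psi> \<Longrightarrow> C_k k (\<lambda>x. a * \<phi> x + b * \<psi> x)"
proof (induction k arbitrary: \<phi> \<psi>)
  case 0
  then show ?case by (auto intro!: continuous_intros)
next
  case (Suc k)
  show ?case
    by (rule C_k_SucI[OF lincomb_has_derivative[OF Suc.prems]]) (use Suc in auto)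
qed

lemma C_k_mult:
  "C_k k \<phi> \<Longrightarrow> C_k k \<psi> \<Longrightarrow> C_k k (\<lambda>x. \<phi> x * \<psi> x)"
proof (induction k arbitrary: \<phi> \<psi>)
  case 0
  then show ?case by (auto intro!: continuous_intros)
next
  case (Suc k)
  note low = Suc.prems[THEN C_k_SucD]
  show ?case
  proof (rule C_k_SucI)
    show "((\<lambda>x. \<phi> x * \<psi> x) has_derivative
        (\<lambda>h. fst h * (1 * (partial1 \<phi> x * \<psi> x) + 1 * (\<phi> x * partial1 \<psi> x)) +
             snd h * (1 * (partial2 \<phi> x * \<psi> x) + 1 * (\<phi> x * partial2 \<psi> x)))) (at x)" for x
      by (auto intro!: derivative_eq_intros C_k_has_derivative[OF Suc.prems(1)]
            C_k_has_derivative[OF Suc.prems(2)] simp: algebra_simps)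
  qed (intro C_k_lincomb Suc.IH low; use Suc.prems in auto)+
qed

lemma partial_translation:
  assumes "C_k (Suc k) \<phi>"
  shows "partial1 (\<lambda>x. \<phi> (x - v)) = (\<lambda>x. partial1 \<phi> (x - v))"
    and "partial2 (\<lambda>x. \<phi> (x - v)) = (\<lambda>x. partial2 \<phi> (x - v))"
    and "((\<lambda>x. \<phi> (x - v)) has_derivative
          (\<lambda>h. fst h * partial1 \<phi> (x - v) + snd h * partial2 \<phi> (x - v))) (at x)"
proof -
  show *: "((\<lambda>x. \<phi> (x - v)) has_derivative
          (\<lambda>h. fst h * partial1 \<phi> (x - v) + snd h * partial2 \<phi> (x - v))) (at x)" for x
  proof -
    have "((\<lambda>x. x - v) has_derivative (\<lambda>h. h)) (at x)"
      by (auto intro!: derivative_eq_intros)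
    from has_derivative_compose[OF this C_k_has_derivative[OF assms]] show ?thesis .
  qed
  show "partial1 (\<lambda>x. \<phi> (x - v)) = (\<lambda>x. partial1 \<phi> (x - v))"
    and "partial2 (\<lambda>x. \<phi> (x - v)) = (\<lambda>x. partial2 \<phi> (x - v))"
    by (rule partials_eqI[OF *])+
qed

lemma C_k_translation: "C_k k \<phi> \<Longrightarrow> C_k k (\<lambda>x. \<phi> (x - v))"
proof (induction k arbitrary: \<phi>)
  case 0
  then show ?case
    by (auto intro!: continuous_on_compose2[of UNIV \<phi>] continuous_intros)
next
  case (Suc k)
  show ?case
    by (rule C_k_SucI[OF partial_translation(3)[OF Suc.prems]]) (use Suc in auto)
qed

text \<open>
  Integrating along a segment of fixed length, rather than along a half line, keeps compact supports
  compact. Being an average of translations, the operator commutes with the partial derivatives and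
  preserves \<open>C_k\<close>.
\<close>

definition segment_integral :: "plane \<Rightarrow> real \<Rightarrow> (plane \<Rightarrow> real) \<Rightarrow> plane \<Rightarrow> real" where
  "segment_integral v R \<phi> x = integral {0..R} (\<lambda>t. \<phi> (x - t *\<^sub>R v))"

lemma segment_integral_has_derivative:
  assumes "C_k (Suc k) \<phi>"
  shows "(segment_integral v R \<phi> has_derivative
     (\<lambda>h. fst h * segment_integral v R (partial1 \<phi>) x
        + snd h * segment_integral v R (partial2 \<phi>) x)) (at x)"
proof -
  let ?p = "\<lambda>x t. partial1 \<phi> (x - t *\<^sub>R v)" and ?q = "\<lambda>x t. partial2 \<phi> (x - t *\<^sub>R v)"
  define D where "D x t = ?p x t *\<^sub>R fst_blinfun + ?q x t *\<^sub>R (snd_blinfun :: plane \<Rightarrow>\<^sub>L real)" for x t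
  have C: "continuous_on UNIV \<phi>" "continuous_on UNIV (partial1 \<phi>)" "continuous_on UNIV (partial2 \<phi>)"
    using assms by (auto intro: C_k_continuous_on differentiable_imp_continuous_on)
  note [continuous_intros] = C[THEN continuous_on_compose2]
  have "((\<lambda>x. integral (cbox 0 R) (\<lambda>t. \<phi> (x - t *\<^sub>R v))) has_derivative
       blinfun_apply (integral (cbox 0 R) (D x))) (at x within UNIV)"
  proof (rule leibniz_rule)
    show "((\<lambda>x. \<phi> (x - t *\<^sub>R v)) has_derivative blinfun_apply (D x t)) (at x within UNIV)" for x t
    proof -
      have "blinfun_apply (D x t) = (\<lambda>h. fst h * ?p x t + snd h * ?q x t)"
        by (auto simp: D_def blinfun.add_left blinfun.scaleR_left)
      then show ?thesis
        using partial_translation(3)[OF assms, of "t *\<^sub>R v" x] by simp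
    qed
    show "(\<lambda>t. \<phi> (x - t *\<^sub>R v)) integrable_on cbox 0 R" for x
      by (intro integrable_continuous continuous_intros) auto
    show "continuous_on (UNIV \<times> cbox 0 R) (\<lambda>(x, t). D x t)"
      unfolding D_def split_beta by (intro continuous_intros) auto
  qed auto
  moreover have "integral (cbox 0 R) (D x) =
      integral (cbox 0 R) (?p x) *\<^sub>R fst_blinfun + integral (cbox 0 R) (?q x) *\<^sub>R snd_blinfun"
  proof -
    have "?p x integrable_on cbox 0 R" "?q x integrable_on cbox 0 R"
      by (intro integrable_continuous continuous_intros; auto)+
    then have "((\<lambda>t. ?p x t *\<^sub>R fst_blinfun) has_integral integral (cbox 0 R) (?p x) *\<^sub>R (fst_blinfun :: plane \<Rightarrow>\<^sub>L real)) (cbox 0 R)"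
      "((\<lambda>t. ?q x t *\<^sub>R snd_blinfun) has_integral integral (cbox 0 R) (?q x) *\<^sub>R (snd_blinfun :: plane \<Rightarrow>\<^sub>L real)) (cbox 0 R)"
      by (intro has_integral_scaleR_left integrable_integral; simp)+
    from has_integral_add[OF this] show ?thesis
      unfolding D_def by (rule integral_unique)
  qed
  moreover have "blinfun_apply (integral (cbox 0 R) (?p x) *\<^sub>R fst_blinfun
        + integral (cbox 0 R) (?q x) *\<^sub>R snd_blinfun)
      = (\<lambda>h. fst h * integral (cbox 0 R) (?p x) + snd h * integral (cbox 0 R) (?q x))"
    by (auto simp: blinfun.add_left blinfun.scaleR_left)
  ultimately show ?thesis
    by (simp add: segment_integral_def[abs_def])
qed

lemma segment_integral_partials:
  assumes "C_k (Suc k) \<phi>"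
  shows "partial1 (segment_integral v R \<phi>) = segment_integral v R (partial1 \<phi>)"
    and "partial2 (segment_integral v R \<phi>) = segment_integral v R (partial2 \<phi>)"
  by (rule partials_eqI[OF segment_integral_has_derivative[OF assms]])+

lemma C_k_segment_integral: "C_k k \<phi> \<Longrightarrow> C_k k (segment_integral v R \<phi>)"
proof (induction k arbitrary: \<phi>)
  case 0
  then have "continuous_on UNIV \<phi>"
    by simp
  note [continuous_intros] = this[THEN continuous_on_compose2]
  have "continuous_on (UNIV \<times> cbox 0 R) (\<lambda>(x, t). \<phi> (x - t *\<^sub>R v))"
    unfolding split_beta by (intro continuous_intros) auto
  from integral_continuous_on_param[OF this] show ?case
    by (simp add: segment_integral_def[abs_def])
next
  case (Suc k)
  show ?case
    by (rule C_k_SucI[OF segment_integral_has_derivative[OF Suc.prems]]) (use Suc in auto)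
qed

text \<open>
  The fundamental theorem of calculus along the segment: the price of its finite length is a second
  boundary term, a translate of \<open>\<phi>\<close>.
\<close>

lemma segment_integral_derivative:
  assumes "C_k (Suc k) \<phi>" and "0 \<le> R"
  shows "segment_integral v R (\<lambda>x. fst v * partial1 \<phi> x + snd v * partial2 \<phi> x) x
       = \<phi> x - \<phi> (x - R *\<^sub>R v)"
proof -
  have "((\<lambda>t. - \<phi> (x - t *\<^sub>R v)) has_vector_derivative
      fst v * partial1 \<phi> (x - t *\<^sub>R v) + snd v * partial2 \<phi> (x - t *\<^sub>R v)) (at t within {0..R})" for t
  proof -
    have "((\<lambda>t. x - t *\<^sub>R v) has_derivative (\<lambda>h. - h *\<^sub>R v)) (at t within {0..R})"
      by (auto intro!: derivative_eq_intros)
    from has_derivative_compose[OF this C_k_has_derivative[OF assms(1)]]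
    show ?thesis
      unfolding has_vector_derivative_def
      by (auto intro!: derivative_eq_intros simp: algebra_simps)
  qed
  then have "((\<lambda>t. fst v * partial1 \<phi> (x - t *\<^sub>R v) + snd v * partial2 \<phi> (x - t *\<^sub>R v)) has_integral
     (- \<phi> (x - R *\<^sub>R v)) - (- \<phi> (x - 0 *\<^sub>R v))) {0..R}"
    using assms(2) by (intro fundamental_theorem_of_calculus) auto
  then show ?thesis
    unfolding segment_integral_def by (simp add: integral_unique)
qed

lemma partial1_segment_integral:
  assumes "C_k (Suc k) \<phi>" "0 \<le> R"
  shows "partial1 (segment_integral (1, 0) R \<phi>) = (\<lambda>x. \<phi> x - \<phi> (x - (R, 0)))"
  using segment_integral_derivative[OF assms, of "(1, 0)"]
  by (auto simp: segment_integral_partials[OF assms(1)])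

lemma partial2_segment_integral:
  assumes "C_k (Suc k) \<phi>" "0 \<le> R"
  shows "partial2 (segment_integral (0, 1) R \<phi>) = (\<lambda>x. \<phi> x - \<phi> (x - (0, R)))"
  using segment_integral_derivative[OF assms, of "(0, 1)"]
  by (auto simp: segment_integral_partials[OF assms(1)])

section \<open>Test functions and smooth bumps\<close>

lemma test_functionsI:
  assumes "\<And>k. C_k k \<phi>" "closed S" "bounded S" "\<And>x. x \<notin> S \<Longrightarrow> \<phi> x = 0" "S \<subseteq> \<Omega>"
  shows "\<phi> \<in> test_functions \<Omega>"
proof -
  have "{x. \<phi> x \<noteq> 0} \<subseteq> S"
    using assms(4) by auto
  then have sub: "tsupport \<phi> \<subseteq> S"
    unfolding tsupport_def using assms(2) by (rule closure_minimal)
  moreover have "compact (tsupport \<phi>)"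
    using sub bounded_subset[OF assms(3)]
    by (auto simp: compact_eq_bounded_closed tsupport_def)
  ultimately show ?thesis
    using assms by (auto simp: test_functions_def)
qed

lemma not_in_tsupport: "x \<notin> tsupport \<phi> \<Longrightarrow> \<phi> x = 0"
  using closure_subset[of "{x. \<phi> x \<noteq> 0}"] by (auto simp: tsupport_def)

lemma test_functions_mono: "\<Omega> \<subseteq> \<Omega>' \<Longrightarrow> test_functions \<Omega> \<subseteq> test_functions \<Omega>'"
  by (auto simp: test_functions_def)

lemma test_functions_zero: "\<phi> \<in> test_functions \<Omega> \<Longrightarrow> x \<notin> \<Omega> \<Longrightarrow> \<phi> x = 0"
  using not_in_tsupport[of x \<phi>] by (auto simp: test_functions_def)

lemma test_functions_C_k: "\<phi> \<in> test_functions \<Omega> \<Longrightarrow> C_k k \<phi>"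
  by (simp add: test_functions_def)

lemma test_functions_continuous: "\<phi> \<in> test_functions \<Omega> \<Longrightarrow> continuous_on UNIV \<phi>"
  using test_functions_C_k[of \<phi> \<Omega> 0] by simp

lemma test_functions_measurable [measurable_dest]:
  "\<phi> \<in> test_functions \<Omega> \<Longrightarrow> \<phi> \<in> borel_measurable borel"
  by (intro borel_measurable_continuous_onI test_functions_continuous)

lemma test_functions_bound:
  assumes "\<phi> \<in> test_functions \<Omega>"
  obtains B where "\<And>x. \<bar>\<phi> x\<bar> \<le> B"
proof -
  have "compact (\<phi> ` tsupport \<phi>)"
    using assms test_functions_continuous[OF assms] continuous_on_subset
    by (intro compact_continuous_image) (auto simp: test_functions_def)
  then obtain B where B: "\<And>x. x \<in> tsupport \<phi> \<Longrightarrow> \<bar>\<phi> x\<bar> \<le> B"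
    using compact_imp_bounded[of "\<phi> ` tsupport \<phi>"] unfolding bounded_iff by auto
  have "\<bar>\<phi> x\<bar> \<le> max B 0" for x
  proof (cases "x \<in> tsupport \<phi>")
    case False
    then show ?thesis by (simp add: not_in_tsupport)
  qed (use B in fastforce)
  then show ?thesis using that by blast
qed

lemma tsupport_zero_open:
  assumes "x \<notin> tsupport \<phi>"
  shows "eventually (\<lambda>y. \<phi> y = 0) (nhds x)"
proof -
  have "open (- tsupport \<phi>)"
    by (auto simp: tsupport_def)
  then show ?thesis
    using assms closure_subset[of "{x. \<phi> x \<noteq> 0}"]
    unfolding eventually_nhds tsupport_def by (intro exI[of _ "- tsupport \<phi>"]) (auto simp: tsupport_def)
qed

lemma partials_zero_outside_tsupport:
  assumes "x \<notin> tsupport \<phi>"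
  shows "partial1 \<phi> x = 0" "partial2 \<phi> x = 0"
proof -
  have "eventually (\<lambda>y. 0 = \<phi> y) (at x)"
    using tsupport_zero_open[OF assms] by (auto simp: eventually_at_filter elim: eventually_mono)
  moreover have "\<phi> x = 0"
    using assms by (rule not_in_tsupport)
  ultimately have "(\<phi> has_derivative (\<lambda>h. 0)) (at x)"
    using has_derivative_transform_eventually[of "\<lambda>_. 0" "\<lambda>h. 0" x UNIV \<phi>] by simp
  then have "frechet_derivative \<phi> (at x) = (\<lambda>h. 0)"
    by (rule frechet_derivative_at[symmetric])
  then show "partial1 \<phi> x = 0" "partial2 \<phi> x = 0"
    by (simp_all add: partial1_def partial2_def)
qed

lemma test_functions_partials:
  assumes "\<phi> \<in> test_functions \<Omega>"
  shows "partial1 \<phi> \<in> test_functions \<Omega>" "partial2 \<phi> \<in> test_functions \<Omega>"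
proof -
  have "C_k k (partial1 \<phi>)" "C_k k (partial2 \<phi>)" for k
    using test_functions_C_k[OF assms, of "Suc k"] by auto
  moreover have "closed (tsupport \<phi>)" "bounded (tsupport \<phi>)" "tsupport \<phi> \<subseteq> \<Omega>"
    using assms by (auto simp: test_functions_def compact_eq_bounded_closed)
  ultimately show "partial1 \<phi> \<in> test_functions \<Omega>" "partial2 \<phi> \<in> test_functions \<Omega>"
    by (metis test_functionsI partials_zero_outside_tsupport)+
qed

lemma test_functions_lincomb:
  assumes "\<phi> \<in> test_functions \<Omega>" "\<psi> \<in> test_functions \<Omega>"
  shows "(\<lambda>x. a * \<phi> x + b * \<psi> x) \<in> test_functions \<Omega>"
proof (rule test_functionsI[of _ "tsupport \<phi> \<union> tsupport \<psi>"])
  show "a * \<phi> x + b * \<psi> x = 0" if "x \<notin> tsupport \<phi> \<union> tsupport \<psi>" for x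
    using that by (simp add: not_in_tsupport)
qed (use assms in \<open>auto simp: test_functions_def compact_eq_bounded_closed intro: C_k_lincomb\<close>)

text \<open>
  \<open>flat 0\<close> is the classical smooth function that vanishes exactly on the nonpositive reals. The other
  members make the span of the family closed under differentiation, which gives smoothness by
  induction.
\<close>

definition flat :: "nat \<Rightarrow> real \<Rightarrow> real" where
  "flat m t = (if t > 0 then (1 / t) ^ m * exp (- (1 / t)) else 0)"

lemma flat_tendsto_0: "(flat m \<longlongrightarrow> 0) (at_right 0)"
proof -
  have "((\<lambda>t. inverse t ^ m / exp (inverse t)) \<longlongrightarrow> 0) (at_right (0::real))"
    by (rule filterlim_compose[OF tendsto_power_div_exp_0 filterlim_inverse_at_top_right])
  moreover have "eventually (\<lambda>t. inverse t ^ m / exp (inverse t) = flat m t) (at_right 0)"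
    unfolding eventually_at_filter
    by (rule always_eventually) (auto simp: flat_def exp_minus divide_inverse)
  ultimately show ?thesis
    by (rule Lim_transform_eventually)
qed

lemma flat_has_real_derivative:
  "(flat m has_real_derivative flat (m + 2) t - m * flat (m + 1) t) (at t)"
proof -
  consider "t > 0" | "t < 0" | "t = 0" by linarith
  then show ?thesis
  proof cases
    case 1
    have "((\<lambda>t. 1 / t) has_real_derivative - ((1 / t) * (1 / t))) (at t)"
      using 1 by (auto intro!: derivative_eq_intros)
    note inv = this DERIV_power_Suc[OF this]
    have "((\<lambda>t. (1 / t) ^ m) has_real_derivative - m * (1 / t) ^ (m + 1)) (at t)"
    proof (cases m)
      case (Suc k)
      show ?thesis
        unfolding Suc by (rule DERIV_cong[OF inv(2)]) (use 1 in \<open>simp add: field_simps\<close>)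
    qed simp
    from DERIV_mult[OF this DERIV_fun_exp[OF DERIV_minus[OF inv(1)]]]
    have "((\<lambda>t. (1 / t) ^ m * exp (- (1 / t))) has_real_derivative
        flat (m + 2) t - m * flat (m + 1) t) (at t)"
      by (rule DERIV_cong) (use 1 in \<open>simp add: flat_def field_simps power2_eq_square\<close>)
    moreover have "eventually (\<lambda>s. s \<in> {0<..}) (nhds t)"
      using 1 by (intro eventually_nhds_in_open) auto
    ultimately show ?thesis
      by (subst DERIV_cong_ev[of t t "flat m" "\<lambda>t. (1 / t) ^ m * exp (- (1 / t))", OF refl _ refl])
         (auto elim: eventually_mono simp: flat_def)
  next
    case 2
    have "eventually (\<lambda>s. s \<in> {..<0}) (nhds t)"
      using 2 by (intro eventually_nhds_in_open) auto
    then show ?thesis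
      using 2 by (subst DERIV_cong_ev[of t t "flat m" "\<lambda>t. 0", OF refl _ refl])
         (auto elim: eventually_mono simp: flat_def)
  next
    case 3
    have "((\<lambda>s. flat m s / s) \<longlongrightarrow> 0) (at_right 0)"
    proof (rule Lim_transform_eventually[OF flat_tendsto_0[of "m + 1"]])
      show "eventually (\<lambda>s. flat (m + 1) s = flat m s / s) (at_right 0)"
        unfolding eventually_at_filter by (rule always_eventually) (auto simp: flat_def)
    qed
    moreover have "((\<lambda>s. flat m s / s) \<longlongrightarrow> 0) (at_left 0)"
      by (rule Lim_transform_eventually[OF tendsto_const])
         (auto simp: eventually_at_filter flat_def)
    ultimately have "((\<lambda>s. flat m s / s) \<longlongrightarrow> 0) (at 0)"
      by (simp add: filterlim_split_at_real)
    then show ?thesis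
      using 3 by (simp add: DERIV_def flat_def)
  qed
qed

lemma C_k_flat: "C_k k (\<lambda>x. flat m (\<alpha> + \<beta> * fst x + \<gamma> * snd x))"
proof (induction k arbitrary: m)
  case 0
  have "continuous_on UNIV (flat m)"
    using flat_has_real_derivative DERIV_isCont continuous_at_imp_continuous_on by blast
  then show ?case
    by (auto intro!: continuous_on_compose2[of UNIV "flat m"] continuous_intros)
next
  case (Suc k)
  let ?l = "\<lambda>x. \<alpha> + \<beta> * fst x + \<gamma> * snd x"
  show ?case
  proof (rule C_k_SucI)
    fix x :: plane
    have "(?l has_derivative (\<lambda>h. \<beta> * fst h + \<gamma> * snd h)) (at x)"
      by (auto intro!: derivative_eq_intros)
    from has_derivative_compose[OF this flat_has_real_derivative[of m "?l x", unfolded has_field_derivative_def]]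
    show "((\<lambda>x. flat m (?l x)) has_derivative
       (\<lambda>h. fst h * (\<beta> * flat (m + 2) (?l x) + (- \<beta> * m) * flat (m + 1) (?l x)) +
            snd h * (\<gamma> * flat (m + 2) (?l x) + (- \<gamma> * m) * flat (m + 1) (?l x)))) (at x)"
      by (rule has_derivative_eq_rhs) (auto simp: algebra_simps)
  qed (intro C_k_lincomb Suc)+
qed

text \<open>
  The sharpness \<open>r\<close> changes the shape of the bump but not its support; the bumps are products of one
  variable functions so that their iterated integrals factor.
\<close>

definition bump :: "real \<Rightarrow> real \<Rightarrow> real \<Rightarrow> real \<Rightarrow> real" where
  "bump r a b t = flat 0 (r * (t - a)) * flat 0 (r * (b - t))"

definition box_bump :: "real \<Rightarrow> plane \<Rightarrow> plane \<Rightarrow> plane \<Rightarrow> real" where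
  "box_bump r p q x = bump r (fst p) (fst q) (fst x) * bump r (snd p) (snd q) (snd x)"

lemma flat_0_bounds: "0 \<le> flat 0 t" "flat 0 t \<le> 1"
  by (auto simp: flat_def)

lemma bump_bounds: "0 \<le> bump r a b t" "bump r a b t \<le> 1"
  using flat_0_bounds by (auto simp: bump_def intro: mult_le_one)

lemma bump_pos_iff: "r > 0 \<Longrightarrow> bump r a b t > 0 \<longleftrightarrow> a < t \<and> t < b"
  by (auto simp: bump_def flat_def zero_less_mult_iff)

lemma bump_eq_0_iff: "r > 0 \<Longrightarrow> bump r a b t = 0 \<longleftrightarrow> \<not> (a < t \<and> t < b)"
  using bump_pos_iff[of r a b t] bump_bounds(1)[of r a b t] by linarith

lemma continuous_on_bump: "continuous_on UNIV (bump r a b)"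
proof -
  have "continuous_on UNIV (flat 0)"
    using flat_has_real_derivative DERIV_isCont continuous_at_imp_continuous_on by blast
  note [continuous_intros] = this[THEN continuous_on_compose2]
  show ?thesis
    unfolding bump_def[abs_def] by (intro continuous_intros) auto
qed

lemma box_bump_bounds: "0 \<le> box_bump r p q x" "box_bump r p q x \<le> 1"
  using bump_bounds by (auto simp: box_bump_def intro: mult_le_one)

lemma mem_box_plane: "x \<in> box p q \<longleftrightarrow> fst p < fst x \<and> fst x < fst q \<and> snd p < snd x \<and> snd x < snd (q::plane)"
  by (cases p; cases q; cases x) (auto simp: mem_box Basis_prod_def)

lemma mem_cbox_plane: "x \<in> cbox p q \<longleftrightarrow> fst p \<le> fst x \<and> fst x \<le> fst q \<and> snd p \<le> snd x \<and> snd x \<le> snd (q::plane)"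
  by (cases p; cases q; cases x) (auto simp: mem_box Basis_prod_def)

lemma box_bump_eq_0: "r > 0 \<Longrightarrow> x \<notin> box p q \<Longrightarrow> box_bump r p q x = 0"
  by (auto simp: box_bump_def bump_eq_0_iff mem_box_plane)

lemma box_bump_in_test_functions:
  assumes "r > 0" "cbox p q \<subseteq> \<Omega>"
  shows "box_bump r p q \<in> test_functions \<Omega>"
proof (rule test_functionsI[of _ "cbox p q"])
  have eq: "box_bump r p q = (\<lambda>x.
      (flat 0 (- r * fst p + r * fst x + 0 * snd x) * flat 0 (r * fst q + (- r) * fst x + 0 * snd x)) *
      (flat 0 (- r * snd p + 0 * fst x + r * snd x) * flat 0 (r * snd q + 0 * fst x + (- r) * snd x)))"
    by (auto simp: box_bump_def bump_def algebra_simps fun_eq_iff)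
  show "C_k k (box_bump r p q)" for k
    unfolding eq by (intro C_k_mult C_k_flat)
  show "box_bump r p q x = 0" if "x \<notin> cbox p q" for x
    using box_subset_cbox[of p q] that assms(1) by (intro box_bump_eq_0) auto
qed (use assms in auto)

text \<open>
  Steepening the bumps, rather than moving their supports, exhausts the open box: for positive
  \<open>s\<close>, \<open>flat 0 (r * s) = exp (- 1 / (r * s))\<close> tends to 1 as \<open>r\<close> tends to infinity.
\<close>

lemma box_bump_tendsto_indicator:
  "(\<lambda>n. box_bump (real (Suc n)) p q x) \<longlonglongrightarrow> indicator (box p q) x"
proof (cases "x \<in> box p q")
  case True
  have *: "(\<lambda>n. flat 0 (real (Suc n) * s)) \<longlonglongrightarrow> 1" if "s > 0" for s
  proof -
    have "(\<lambda>n. exp (- (inverse (real (Suc n)) * inverse s))) \<longlonglongrightarrow> exp (- (0 * inverse s))"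
      by (intro tendsto_intros LIMSEQ_inverse_real_of_nat)
    then show ?thesis
      using that by (simp add: flat_def divide_inverse zero_less_mult_iff mult.commute)
  qed
  have "(\<lambda>n. box_bump (real (Suc n)) p q x) \<longlonglongrightarrow> (1 * 1) * (1 * 1)"
    unfolding box_bump_def bump_def
    by (intro tendsto_mult *) (use True in \<open>auto simp: mem_box_plane\<close>)
  then show ?thesis using True by simp
next
  case False
  then show ?thesis by (simp add: box_bump_eq_0)
qed

section \<open>Jordan decomposition of signed measures\<close>

lemma signed_measure_outside: "signed_measure \<mu> \<Longrightarrow> A \<notin> sets borel \<Longrightarrow> \<mu> A = 0"
  by (simp add: signed_measure_def)

lemma signed_measure_sums:
  "signed_measure \<mu> \<Longrightarrow> range A \<subseteq> sets borel \<Longrightarrow> disjoint_family A \<Longrightarrow> (\<lambda>i. \<mu> (A i)) sums \<mu> (\<Union>i. A i)"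
  by (simp add: signed_measure_def)

lemma signed_measure_empty:
  assumes "signed_measure \<mu>"
  shows "\<mu> {} = 0"
proof -
  have "(\<lambda>i::nat. \<mu> {}) sums \<mu> {}"
    using signed_measure_sums[OF assms, of "\<lambda>_. {}"] by (simp add: disjoint_family_on_def)
  then show ?thesis
    by (simp only: sums_summable summable_const_iff[symmetric])
qed

lemma signed_measure_Un:
  assumes "signed_measure \<mu>" "A \<in> sets borel" "B \<in> sets borel" "A \<inter> B = {}"
  shows "\<mu> (A \<union> B) = \<mu> A + \<mu> B"
proof -
  have "(\<lambda>i. \<mu> (binaryset A B i)) sums \<mu> (\<Union>i. binaryset A B i)"
    using assms by (intro signed_measure_sums)
      (auto simp: disjoint_family_on_def binaryset_def range_binaryset_eq)
  moreover have "(\<lambda>i. \<mu> (binaryset A B i)) sums (\<mu> A + \<mu> B)"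
    by (intro binaryset_sums signed_measure_empty assms)
  ultimately show ?thesis
    by (simp add: UN_binaryset_eq sums_unique2)
qed

lemma signed_measure_Diff:
  assumes "signed_measure \<mu>" "A \<in> sets borel" "B \<in> sets borel" "B \<subseteq> A"
  shows "\<mu> (A - B) = \<mu> A - \<mu> B"
proof -
  have "(A - B) \<inter> B = {}" "A - B \<union> B = A"
    using assms(4) by blast+
  then show ?thesis
    using signed_measure_Un[OF assms(1) sets.Diff[OF assms(2,3)] assms(3)] by (metis add_diff_cancel_right')
qed

lemma signed_measure_uminus: "signed_measure \<mu> \<Longrightarrow> signed_measure (\<lambda>A. - \<mu> A)"
  by (auto simp: signed_measure_def intro: sums_minus)

abbreviation upper :: "(plane set \<Rightarrow> real) \<Rightarrow> plane set \<Rightarrow> ennreal" where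
  "upper \<mu> A \<equiv> SUP B\<in>{B \<in> sets borel. B \<subseteq> A}. ennreal (\<mu> B)"

lemma upper_upper: "B \<in> sets borel \<Longrightarrow> B \<subseteq> A \<Longrightarrow> ennreal (\<mu> B) \<le> upper \<mu> A"
  by (intro SUP_upper) auto

lemma upper_mono: "A \<subseteq> A' \<Longrightarrow> upper \<mu> A \<le> upper \<mu> A'"
  by (intro SUP_subset_mono) auto

text \<open>
  Two subsets of nonnegative charge can be united; a subset of negative charge contributes 0 and can be
  dropped.
\<close>

lemma upper_superadditive:
  assumes "signed_measure \<mu>" "A \<inter> B = {}"
  shows "upper \<mu> A + upper \<mu> B \<le> upper \<mu> (A \<union> B)"
proof -
  have *: "ennreal (\<mu> C) + ennreal (\<mu> D) \<le> upper \<mu> (A \<union> B)"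
    if CD: "C \<in> sets borel" "C \<subseteq> A" "D \<in> sets borel" "D \<subseteq> B" for C D
  proof -
    consider "\<mu> C < 0" | "\<mu> D < 0" | "\<mu> C \<ge> 0" "\<mu> D \<ge> 0" by linarith
    then show ?thesis
    proof cases
      case 1
      then have "ennreal (\<mu> C) + ennreal (\<mu> D) = ennreal (\<mu> D)"
        by (simp add: ennreal_neg)
      also have "\<dots> \<le> upper \<mu> (A \<union> B)"
        using CD by (intro upper_upper) auto
      finally show ?thesis .
    next
      case 2
      then have "ennreal (\<mu> C) + ennreal (\<mu> D) = ennreal (\<mu> C)"
        by (simp add: ennreal_neg)
      also have "\<dots> \<le> upper \<mu> (A \<union> B)"
        using CD by (intro upper_upper) auto
      finally show ?thesis .
    next
      case 3
      then have "ennreal (\<mu> C) + ennreal (\<mu> D) = ennreal (\<mu> (C \<union> D))"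
      proof -
        have "C \<inter> D = {}"
          using CD assms(2) by blast
        then show ?thesis
          using 3 signed_measure_Un[OF assms(1) CD(1,3)] by simp
      qed
      also have "\<dots> \<le> upper \<mu> (A \<union> B)"
        using CD by (intro upper_upper) auto
      finally show ?thesis .
    qed
  qed
  have ne: "{B \<in> sets borel. B \<subseteq> X} \<noteq> {}" for X :: "plane set"
    by auto
  have "ennreal (\<mu> C) + upper \<mu> B \<le> upper \<mu> (A \<union> B)" if "C \<in> sets borel" "C \<subseteq> A" for C
    unfolding ennreal_SUP_add_right[OF ne]
    by (rule SUP_least) (use * that in blast)
  then show ?thesis
    unfolding ennreal_SUP_add_left[OF ne, symmetric]
    by (intro SUP_least) auto
qed

lemma ennreal_add_le: "ennreal (a + b) \<le> ennreal a + ennreal b"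
proof -
  have pos: "ennreal (max 0 c) = ennreal c" for c
    by (simp add: max_def ennreal_neg)
  have "ennreal (a + b) \<le> ennreal (max 0 a + max 0 b)"
    by (intro ennreal_leI) simp
  also have "\<dots> = ennreal a + ennreal b"
    by (subst ennreal_plus) (simp_all add: pos)
  finally show ?thesis .
qed

lemma ennreal_sums_le_suminf:
  assumes "f sums s"
  shows "ennreal s \<le> (\<Sum>i. ennreal (f i))"
proof (rule LIMSEQ_le_const2)
  show "(\<lambda>n. ennreal (\<Sum>i<n. f i)) \<longlonglongrightarrow> ennreal s"
    using assms by (intro tendsto_ennrealI) (simp add: sums_def)
  have "ennreal (\<Sum>i<n. f i) \<le> (\<Sum>i<n. ennreal (f i))" for n
  proof (induction n)
    case (Suc n)
    have "ennreal ((\<Sum>i<n. f i) + f n) \<le> ennreal (\<Sum>i<n. f i) + ennreal (f n)"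
      by (rule ennreal_add_le)
    also have "\<dots> \<le> (\<Sum>i<n. ennreal (f i)) + ennreal (f n)"
      using Suc by (intro add_mono) auto
    finally show ?case by simp
  qed simp
  moreover have "(\<Sum>i<n. ennreal (f i)) \<le> (\<Sum>i. ennreal (f i))" for n
    by (intro sum_le_suminf summableI) auto
  ultimately have "ennreal (\<Sum>i<n. f i) \<le> (\<Sum>i. ennreal (f i))" for n
    by (rule order_trans)
  then show "\<exists>N. \<forall>n\<ge>N. ennreal (\<Sum>i<n. f i) \<le> (\<Sum>i. ennreal (f i))"
    by blast
qed

lemma countably_additive_upper:
  assumes \<mu>: "signed_measure \<mu>"
  shows "countably_additive (sets borel) (upper \<mu>)"
proof (rule countably_additiveI)
  fix A :: "nat \<Rightarrow> plane set"
  assume A: "range A \<subseteq> sets borel" "disjoint_family A"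
  show "(\<Sum>i. upper \<mu> (A i)) = upper \<mu> (\<Union>i. A i)"
  proof (rule antisym)
    have "(\<Sum>i<n. upper \<mu> (A i)) \<le> upper \<mu> (\<Union>i<n. A i)" for n
    proof (induction n)
      case (Suc n)
      have disj: "(\<Union>i<n. A i) \<inter> A n = {}"
      proof -
        have "A i \<inter> A n = {}" if "i < n" for i
          using disjoint_family_onD[OF A(2), of i n] that by simp
        then show ?thesis by blast
      qed
      have "(\<Sum>i<Suc n. upper \<mu> (A i)) \<le> upper \<mu> (\<Union>i<n. A i) + upper \<mu> (A n)"
        using Suc by (simp add: add_mono)
      also have "\<dots> \<le> upper \<mu> ((\<Union>i<n. A i) \<union> A n)"
        by (rule upper_superadditive[OF \<mu> disj])
      also have "(\<Union>i<n. A i) \<union> A n = (\<Union>i<Suc n. A i)"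
        by (auto simp: less_Suc_eq)
      finally show ?case .
    qed simp
    then have "(\<Sum>i<n. upper \<mu> (A i)) \<le> upper \<mu> (\<Union>i. A i)" for n
      by (rule order_trans) (auto intro!: upper_mono)
    then show "(\<Sum>i. upper \<mu> (A i)) \<le> upper \<mu> (\<Union>i. A i)"
      by (intro suminf_le_const) auto
  next
    show "upper \<mu> (\<Union>i. A i) \<le> (\<Sum>i. upper \<mu> (A i))"
    proof (rule SUP_least)
      fix B assume "B \<in> {B \<in> sets borel. B \<subseteq> (\<Union>i. A i)}"
      then have B: "B \<in> sets borel" "B = (\<Union>i. B \<inter> A i)" by auto
      have "(\<lambda>i. \<mu> (B \<inter> A i)) sums \<mu> (\<Union>i. B \<inter> A i)"
        using A B(1) by (intro signed_measure_sums[OF \<mu>]) (auto simp: disjoint_family_on_def)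
      from ennreal_sums_le_suminf[OF this]
      have "ennreal (\<mu> B) \<le> (\<Sum>i. ennreal (\<mu> (B \<inter> A i)))"
        using B(2) by simp
      also have "\<dots> \<le> (\<Sum>i. upper \<mu> (A i))"
        using A B(1) by (intro suminf_le upper_upper summableI) auto
      finally show "ennreal (\<mu> B) \<le> (\<Sum>i. upper \<mu> (A i))" .
    qed
  qed
qed

lemma sets_upper_variation [simp, measurable_cong]: "sets (upper_variation \<mu>) = sets borel"
  and space_upper_variation [simp]: "space (upper_variation \<mu>) = UNIV"
proof -
  have "sets borel \<subseteq> Pow (UNIV :: plane set)" by auto
  then show "sets (upper_variation \<mu>) = sets borel" "space (upper_variation \<mu>) = UNIV"
    using sets.sigma_sets_eq[of "borel :: plane measure"]
    by (auto simp: upper_variation_def)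
qed

lemma emeasure_upper_variation:
  assumes "signed_measure \<mu>" "A \<in> sets borel"
  shows "emeasure (upper_variation \<mu>) A = upper \<mu> A"
  unfolding upper_variation_def
proof (rule emeasure_measure_of_sigma)
  show "sigma_algebra UNIV (sets (borel :: plane measure))"
    using sets.sigma_algebra_axioms[of "borel :: plane measure"] by simp
  have "{B. B \<in> sets borel \<and> B = {}} = {{} :: plane set}" by auto
  then show "positive (sets borel) (upper \<mu>)"
    using assms(1) by (simp add: positive_def signed_measure_empty)
qed (use assms countably_additive_upper in auto)

text \<open>
  If the upper variation were infinite, some Borel set could be split into two parts of charge
  larger than 1 in absolute value, one of which again has infinite upper variation. Repeating
  this yields disjoint sets whose charges do not tend to 0.
\<close>

lemma finite_upper_variation:
  assumes \<mu>: "signed_measure \<mu>"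
  shows "finite_measure (upper_variation \<mu>)"
proof (rule finite_measureI, rule notI)
  assume "emeasure (upper_variation \<mu>) (space (upper_variation \<mu>)) = \<infinity>"
  then have inf: "upper \<mu> UNIV = \<infinity>"
    using emeasure_upper_variation[OF \<mu>, of UNIV] by simp
  let ?P = "\<lambda>E. E \<in> sets borel \<and> upper \<mu> E = \<infinity>"
  let ?Q = "\<lambda>E F. F \<subseteq> E \<and> \<bar>\<mu> (E - F)\<bar> > 1"
  have step: "\<exists>F. ?P F \<and> ?Q E F" if "?P E" for E
  proof -
    have E: "E \<in> sets borel" and infE: "upper \<mu> E = \<infinity>" using that by auto
    \<comment> \<open>A subset charged more than \<open>1 + \<bar>\<mu> E\<bar>\<close> forces its complement in \<open>E\<close> below \<open>- 1\<close>, so either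
      of the two may be split off.\<close>
    have "ennreal (1 + \<bar>\<mu> E\<bar>) < upper \<mu> E"
      unfolding infE by simp
    then obtain B where B: "B \<in> sets borel" "B \<subseteq> E" and "ennreal (1 + \<bar>\<mu> E\<bar>) < ennreal (\<mu> B)"
      unfolding less_SUP_iff by auto
    then have large: "\<mu> B > 1 + \<bar>\<mu> E\<bar>"
      by (subst (asm) ennreal_less_iff) auto
    have "upper \<mu> B + upper \<mu> (E - B) = upper \<mu> E"
      using emeasure_Diff[of "upper_variation \<mu>"]
        plus_emeasure[of B "upper_variation \<mu>" "E - B"] E B
      by (simp add: emeasure_upper_variation[OF \<mu>] Un_absorb1)
    then have "upper \<mu> B = \<infinity> \<or> upper \<mu> (E - B) = \<infinity>"
      using infE by (auto simp: ennreal_add_eq_top infinity_ennreal_def)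
    then show ?thesis
    proof
      assume "upper \<mu> B = \<infinity>"
      moreover have "\<mu> (E - B) = \<mu> E - \<mu> B"
        by (rule signed_measure_Diff[OF \<mu> E B])
      ultimately show ?thesis
        using B large by (intro exI[of _ B]) auto
    next
      assume "upper \<mu> (E - B) = \<infinity>"
      moreover have "E - (E - B) = B"
        using B by auto
      ultimately show ?thesis
        using B E large by (intro exI[of _ "E - B"]) auto
    qed
  qed
  have "\<exists>E. \<forall>n. ?P (E n) \<and> ?Q (E n) (E (Suc n))"
  proof (intro dependent_nat_choice)
    show "\<exists>E. ?P E"
      using inf by (intro exI[of _ UNIV] conjI) (simp, assumption)
  qed (rule step)
  then obtain E where "\<forall>n. ?P (E n) \<and> ?Q (E n) (E (Suc n))" ..
  then have E: "\<And>n. E n \<in> sets borel" "\<And>n. E (Suc n) \<subseteq> E n"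
    "\<And>n. \<bar>\<mu> (E n - E (Suc n))\<bar> > 1"
    by auto
  have dec: "E n \<subseteq> E m" if "m \<le> n" for m n
    using lift_Suc_antimono_le[of E, OF E(2) that] .
  have "(\<lambda>n. \<mu> (E n - E (Suc n))) sums \<mu> (\<Union>n. E n - E (Suc n))"
  proof (rule signed_measure_sums[OF \<mu>])
    have "(E m - E (Suc m)) \<inter> (E n - E (Suc n)) = {}" if "m < n" for m n
      using dec[of "Suc m" n] that by auto
    then show "disjoint_family (\<lambda>n. E n - E (Suc n))"
      unfolding disjoint_family_on_def by (simp add: neq_iff) (metis inf_commute)
  qed (use E in auto)
  then have "(\<lambda>n. \<mu> (E n - E (Suc n))) \<longlonglongrightarrow> 0"
    by (intro summable_LIMSEQ_zero sums_summable)
  then have "eventually (\<lambda>n. \<bar>\<mu> (E n - E (Suc n))\<bar> < 1) sequentially"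
    using order_tendstoD(2)[OF tendsto_rabs_zero, of _ sequentially 1] by simp
  then obtain n where "\<bar>\<mu> (E n - E (Suc n))\<bar> < 1"
    by (auto simp: eventually_sequentially)
  then show False
    using E(3)[of n] by simp
qed

lemma finite_lower_variation: "signed_measure \<mu> \<Longrightarrow> finite_measure (lower_variation \<mu>)"
  unfolding lower_variation_def by (intro finite_upper_variation signed_measure_uminus)

lemma sets_lower_variation [simp, measurable_cong]: "sets (lower_variation \<mu>) = sets borel"
  and space_lower_variation [simp]: "space (lower_variation \<mu>) = UNIV"
  by (simp_all add: lower_variation_def)

text \<open>
  The Jordan decomposition follows directly from the suprema, without a Hahn decomposition: as the
  charge of \<open>B\<close> is that of \<open>A\<close> minus that of \<open>A - B\<close>, the supremum of the charges of the subsets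
  of \<open>A\<close> and that of their negatives differ by the charge of \<open>A\<close>.
\<close>

lemma measure_upper_variation_le:
  assumes \<mu>: "signed_measure \<mu>" and A: "A \<in> sets borel"
  shows "measure (upper_variation \<mu>) A \<le> \<mu> A + measure (lower_variation \<mu>) A"
proof -
  interpret L: finite_measure "lower_variation \<mu>"
    using finite_lower_variation[OF \<mu>] .
  have le: "- \<mu> C \<le> measure (lower_variation \<mu>) A" if "C \<in> sets borel" "C \<subseteq> A" for C
  proof -
    have "ennreal (- \<mu> C) \<le> emeasure (lower_variation \<mu>) A"
      unfolding lower_variation_def emeasure_upper_variation[OF signed_measure_uminus[OF \<mu>] A]
      using that by (rule upper_upper[where \<mu> = "\<lambda>A. - \<mu> A"])
    then show ?thesis
      by (simp add: L.emeasure_eq_measure)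
  qed
  have bound: "\<mu> B \<le> \<mu> A + measure (lower_variation \<mu>) A" if "B \<in> sets borel" "B \<subseteq> A" for B
    using le[of "A - B"] signed_measure_Diff[OF \<mu> A, of B] that A by auto
  have "emeasure (upper_variation \<mu>) A \<le> ennreal (\<mu> A + measure (lower_variation \<mu>) A)"
    unfolding emeasure_upper_variation[OF \<mu> A]
    by (intro SUP_least ennreal_leI bound) auto
  moreover have "0 \<le> \<mu> A + measure (lower_variation \<mu>) A"
    using bound[of "{}"] signed_measure_empty[OF \<mu>] by simp
  ultimately show ?thesis
    by (simp add: finite_measure.emeasure_eq_measure[OF finite_upper_variation[OF \<mu>]])
qed

lemma Jordan_decomposition:
  assumes \<mu>: "signed_measure \<mu>" and A: "A \<in> sets borel"
  shows "\<mu> A = measure (upper_variation \<mu>) A - measure (lower_variation \<mu>) A"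
  using measure_upper_variation_le[OF \<mu> A]
    measure_upper_variation_le[OF signed_measure_uminus[OF \<mu>] A]
  by (simp add: lower_variation_def)

section \<open>Uniqueness of the representing measure\<close>

lemma signed_integral_box_bump_tendsto:
  assumes \<mu>: "signed_measure \<mu>"
  shows "(\<lambda>n. signed_integral \<mu> (box_bump (real (Suc n)) p q)) \<longlonglongrightarrow> \<mu> (box p q)"
proof -
  have lim: "(\<lambda>n. LINT x|M. box_bump (real (Suc n)) p q x) \<longlonglongrightarrow> measure M (box p q)"
    if M: "finite_measure M" and sets[measurable_cong, simp]: "sets M = sets borel" for M
  proof -
    interpret finite_measure M by fact
    have space[simp]: "space M = UNIV"
      using sets_eq_imp_space_eq[OF sets] by simp
    have "(\<lambda>n. LINT x|M. box_bump (real (Suc n)) p q x) \<longlonglongrightarrow> (LINT x|M. indicator (box p q) x)"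
    proof (rule integral_dominated_convergence[where w = "\<lambda>_. 1"])
      show "box_bump (real (Suc n)) p q \<in> borel_measurable M" for n
        using test_functions_measurable[OF box_bump_in_test_functions[of "real (Suc n)" p q UNIV]]
        by simp
    qed (use box_bump_tendsto_indicator box_bump_bounds in auto)
    then show ?thesis by simp
  qed
  have "(\<lambda>n. (LINT x|upper_variation \<mu>. box_bump (real (Suc n)) p q x)
      - (LINT x|lower_variation \<mu>. box_bump (real (Suc n)) p q x))
    \<longlonglongrightarrow> measure (upper_variation \<mu>) (box p q) - measure (lower_variation \<mu>) (box p q)"
    by (intro tendsto_diff lim finite_upper_variation finite_lower_variation \<mu>) auto
  then show ?thesis
    by (simp add: signed_integral_def Jordan_decomposition[OF \<mu>])
qed

lemma signed_measure_incseq: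
  assumes \<mu>: "signed_measure \<mu>" and A: "range A \<subseteq> sets borel" "incseq A"
  shows "(\<lambda>n. \<mu> (A n)) \<longlonglongrightarrow> \<mu> (\<Union>n. A n)"
proof -
  have lim: "(\<lambda>n. measure M (A n)) \<longlonglongrightarrow> measure M (\<Union>n. A n)"
    if "finite_measure M" "sets M = sets borel" for M
    using that A finite_measure.emeasure_finite by (intro Lim_measure_incseq) auto
  have "A n \<in> sets borel" for n
    using A by auto
  then show ?thesis
    using tendsto_diff[OF lim[OF finite_upper_variation[OF \<mu>]] lim[OF finite_lower_variation[OF \<mu>]]]
    by (simp add: Jordan_decomposition[OF \<mu>])
qed

text \<open>
  Open boxes are stable under intersection and generate the Borel sets, so Dynkin's argument applies to
  signed measures as well; the total charges agree because boxes exhaust the plane.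
\<close>

lemma signed_measure_eqI:
  assumes \<mu>: "signed_measure \<mu>" and \<nu>: "signed_measure \<nu>"
    and box: "\<And>p q. \<mu> (box p q) = \<nu> (box p q)"
  shows "\<mu> = \<nu>"
proof
  fix A :: "plane set"
  have total: "\<mu> UNIV = \<nu> UNIV"
  proof -
    define B :: "nat \<Rightarrow> plane set" where "B n = box (- real n, - real n) (real n, real n)" for n
    have "incseq B"
      by (auto simp: incseq_def B_def mem_box_plane)
    moreover have "(\<Union>n. B n) = UNIV"
    proof -
      have "x \<in> (\<Union>n. B n)" for x
      proof -
        obtain n where "max \<bar>fst x\<bar> \<bar>snd x\<bar> < real n"
          using reals_Archimedean2 by blast
        then have "x \<in> B n"
          by (auto simp: B_def mem_box_plane)
        then show ?thesis by blast
      qed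
      then show ?thesis by blast
    qed
    moreover have "\<mu> (B n) = \<nu> (B n)" for n
      by (simp add: B_def box)
    ultimately show ?thesis
      using signed_measure_incseq[OF \<mu>, of B] signed_measure_incseq[OF \<nu>, of B] LIMSEQ_unique
      by (force simp: B_def)
  qed
  show "\<mu> A = \<nu> A"
  proof (cases "A \<in> sets borel")
    case True
    define G :: "plane set set" where "G = range (\<lambda>(a, b). box a b)"
    have sigma: "sets borel = sigma_sets UNIV G"
      unfolding G_def by (subst borel_eq_box) auto
    have "Int_stable G"
      unfolding Int_stable_def G_def by (force simp: box_Int_box)
    moreover have G_subset: "G \<subseteq> Pow UNIV"
      by simp
    ultimately show ?thesis
      using True[unfolded sigma]
    proof (induction rule: sigma_sets_induct_disjoint)
      case (basic A)
      then show ?case by (auto simp: G_def box)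
    next
      case empty
      then show ?case by (simp add: signed_measure_empty \<mu> \<nu>)
    next
      case (compl A)
      then show ?case
        using signed_measure_Diff[OF \<mu>, of UNIV A] signed_measure_Diff[OF \<nu>, of UNIV A] total sigma
          sigma_sets_top[of UNIV G]
        by simp
    next
      case (union A)
      have "(\<lambda>i. \<mu> (A i)) sums \<mu> (\<Union>i. A i)"
        using union(1,2) sigma by (intro signed_measure_sums \<mu>) auto
      moreover have "(\<lambda>i. \<nu> (A i)) sums \<nu> (\<Union>i. A i)"
        using union(1,2) sigma by (intro signed_measure_sums \<nu>) auto
      ultimately show ?case
        unfolding union(3) by (rule sums_unique2)
    qed
  qed (simp add: signed_measure_outside \<mu> \<nu>)
qed

lemma dist_of_measure_inject:
  assumes \<mu>: "signed_measure \<mu>" and \<nu>: "signed_measure \<nu>"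
    and eq: "dist_of_measure \<mu> = dist_of_measure \<nu>"
  shows "\<mu> = \<nu>"
proof (rule signed_measure_eqI[OF \<mu> \<nu>])
  fix p q
  have "signed_integral \<mu> (box_bump (real (Suc n)) p q) = signed_integral \<nu> (box_bump (real (Suc n)) p q)" for n
    using fun_cong[OF eq, of "box_bump (real (Suc n)) p q"] box_bump_in_test_functions[of "real (Suc n)" p q UNIV]
    by (simp add: dist_of_measure_def)
  then show "\<mu> (box p q) = \<nu> (box p q)"
    using signed_integral_box_bump_tendsto[OF \<mu>, of p q] signed_integral_box_bump_tendsto[OF \<nu>, of p q]
      LIMSEQ_unique by auto
qed

lemma M_norm_dist_of_measure:
  assumes "signed_measure \<mu>"
  shows "M_norm (dist_of_measure \<mu>) = total_variation \<mu>"
proof -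
  have "supported_in UNIV \<mu>"
    using signed_measure_empty[OF assms] by (auto simp: supported_in_def)
  then have "dist_of_measure \<mu> \<in> measures_in UNIV"
    using assms by (auto simp: measures_in_def)
  moreover have "measure_of_dist (dist_of_measure \<mu>) = \<mu>"
    unfolding measure_of_dist_def using assms by (intro the_equality) (auto intro: dist_of_measure_inject)
  ultimately show ?thesis
    by (simp add: M_norm_def)
qed

section \<open>Signed measures with a density\<close>

text \<open>
  The set \<open>H\<close> is a Hahn set: on it the charge is that of \<open>P\<close>, off it there is nothing to gain. Hence
  mutually singular parts are the Jordan decomposition, not just some decomposition.
\<close>

lemma upper_variation_eqI:
  assumes "finite_measure P" "finite_measure N"
    and sets [simp, measurable_cong]: "sets P = sets borel" "sets N = sets borel"
    and \<mu>: "signed_measure \<mu>" "\<And>A. A \<in> sets borel \<Longrightarrow> \<mu> A = measure P A - measure N A"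
    and H: "H \<in> sets borel" "measure P (- H) = 0" "measure N H = 0"
  shows "upper_variation \<mu> = P"
proof (rule measure_eqI)
  interpret P: finite_measure P by fact
  interpret N: finite_measure N by fact
  fix A assume "A \<in> sets (upper_variation \<mu>)"
  then have A: "A \<in> sets borel" by simp
  show "emeasure (upper_variation \<mu>) A = emeasure P A"
    unfolding emeasure_upper_variation[OF \<mu>(1) A]
  proof (rule antisym)
    show "upper \<mu> A \<le> emeasure P A"
      unfolding P.emeasure_eq_measure
    proof (intro SUP_least ennreal_leI)
      fix B assume "B \<in> {B \<in> sets borel. B \<subseteq> A}"
      then have "measure P B \<le> measure P A"
        using A by (intro P.finite_measure_mono) auto
      moreover have "\<mu> B \<le> measure P B"
        using \<mu>(2)[of B] \<open>B \<in> _\<close> by simp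
      ultimately show "\<mu> B \<le> measure P A" by simp
    qed
    have "measure N (A \<inter> H) = 0"
      using N.finite_measure_mono[of "A \<inter> H" H] H by (simp add: measure_le_0_iff)
    moreover have "measure P (A - H) = 0"
      using P.finite_measure_mono[of "A - H" "- H"] H A by (auto simp: measure_le_0_iff)
    then have "measure P (A \<inter> H) = measure P A"
      using P.finite_measure_Union[of "A \<inter> H" "A - H"] A H(1) by (simp add: Int_Diff_Un Int_Diff_disjoint)
    ultimately have "ennreal (\<mu> (A \<inter> H)) = emeasure P A"
      using A H by (simp add: \<mu>(2) P.emeasure_eq_measure)
    then show "emeasure P A \<le> upper \<mu> A"
      using upper_upper[of "A \<inter> H" A \<mu>] A H by auto
  qed
qed simp

text \<open>
  The value 0 on non-Borel sets is what \<open>signed_measure\<close> requires.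
\<close>

definition charge :: "plane measure \<Rightarrow> (plane \<Rightarrow> real) \<Rightarrow> plane set \<Rightarrow> real" where
  "charge \<kappa> g A = (if A \<in> sets borel then LINT x|\<kappa>. g x * indicator A x else 0)"

lemma
  assumes fin: "finite_measure \<kappa>" and sets [simp, measurable_cong]: "sets \<kappa> = sets borel"
    and g: "integrable \<kappa> g"
  shows signed_measure_charge: "signed_measure (charge \<kappa> g)"
    and signed_integral_charge:
      "\<And>\<phi>. \<phi> \<in> borel_measurable borel \<Longrightarrow> (\<And>x. \<bar>\<phi> x\<bar> \<le> B) \<Longrightarrow>
        signed_integral (charge \<kappa> g) \<phi> = (LINT x|\<kappa>. g x * \<phi> x)"
    and total_variation_charge: "total_variation (charge \<kappa> g) = ennreal (LINT x|\<kappa>. \<bar>g x\<bar>)"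
proof -
  interpret finite_measure \<kappa> by fact
  have space [simp]: "space \<kappa> = UNIV"
    using sets_eq_imp_space_eq[OF sets] by simp
  have [measurable]: "g \<in> borel_measurable \<kappa>"
    using g by simp
  then have [measurable]: "g \<in> borel_measurable borel"
    using measurable_cong_sets[OF sets refl, of borel] by simp
  define P where "P = density \<kappa> (\<lambda>x. ennreal (max 0 (g x)))"
  define N where "N = density \<kappa> (\<lambda>x. ennreal (max 0 (- g x)))"
  have sets' [simp, measurable_cong]: "sets P = sets borel" "sets N = sets borel"
    by (simp_all add: P_def N_def)
  have emeasures: "emeasure P UNIV = ennreal (LINT x|\<kappa>. max 0 (g x))"
    "emeasure N UNIV = ennreal (LINT x|\<kappa>. max 0 (- g x))"
    using g by (simp_all add: P_def N_def emeasure_density nn_integral_eq_integral)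
  then have fin': "finite_measure P" "finite_measure N"
    by (auto intro!: finite_measureI simp: P_def N_def)
  have int: "(LINT x|P. \<phi> x) - (LINT x|N. \<phi> x) = (LINT x|\<kappa>. g x * \<phi> x)"
    if [measurable]: "\<phi> \<in> borel_measurable borel" and B: "\<And>x. \<bar>\<phi> x\<bar> \<le> B" for \<phi> B
  proof -
    have "integrable \<kappa> (\<lambda>x. h x * \<phi> x)"
      if "h \<in> borel_measurable \<kappa>" "\<And>x. \<bar>h x\<bar> \<le> \<bar>g x\<bar>" for h
    proof (rule Bochner_Integration.integrable_bound[OF integrable_mult_right[OF g, of B]])
      have "\<bar>h x * \<phi> x\<bar> \<le> \<bar>B * g x\<bar>" for x
        using mult_mono[OF that(2)[of x] order_trans[OF B[of x] abs_ge_self[of B]]]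
        by (simp add: abs_mult mult.commute)
      then show "AE x in \<kappa>. norm (h x * \<phi> x) \<le> norm (B * g x)"
        by simp
    qed (use that(1) in measurable)
    note ig = this[of "\<lambda>x. max 0 (g x)"] this[of "\<lambda>x. max 0 (- g x)"]
    have "(LINT x|P. \<phi> x) = (LINT x|\<kappa>. max 0 (g x) * \<phi> x)"
      "(LINT x|N. \<phi> x) = (LINT x|\<kappa>. max 0 (- g x) * \<phi> x)"
      unfolding P_def N_def by (subst integral_density; simp)+
    then have "(LINT x|P. \<phi> x) - (LINT x|N. \<phi> x)
        = (LINT x|\<kappa>. max 0 (g x) * \<phi> x - max 0 (- g x) * \<phi> x)"
      using ig by simp
    also have "\<dots> = (LINT x|\<kappa>. g x * \<phi> x)"
      by (intro Bochner_Integration.integral_cong) (auto simp: max_def)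
    finally show ?thesis .
  qed
  have charge: "charge \<kappa> g A = measure P A - measure N A" for A
  proof (cases "A \<in> sets borel")
    case True
    moreover have "space P = UNIV" "space N = UNIV"
      by (simp_all add: P_def N_def)
    ultimately show ?thesis
      using int[of "indicator A" 1] by (simp add: charge_def indicator_le_1)
  qed (simp add: charge_def measure_notin_sets)
  show signed: "signed_measure (charge \<kappa> g)"
    unfolding signed_measure_def
  proof (intro conjI allI impI)
    fix A :: "nat \<Rightarrow> plane set"
    assume A: "range A \<subseteq> sets borel" "disjoint_family A"
    show "(\<lambda>i. charge \<kappa> g (A i)) sums charge \<kappa> g (\<Union>i. A i)"
      unfolding charge
      using A by (intro sums_diff finite_measure.finite_measure_UNION fin') auto
  qed (simp add: charge_def)
  define H where "H = {x. g x > 0}"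
  have H: "H \<in> sets borel"
    unfolding H_def by measurable
  have null: "measure P (- H) = 0" "measure N H = 0"
  proof -
    have zero: "ennreal (max 0 (g x)) * indicator (- H) x = 0"
      "ennreal (max 0 (- g x)) * indicator H x = 0" for x
      by (cases "x \<in> H"; simp add: H_def)+
    have "emeasure P (- H) = 0" "emeasure N H = 0"
      unfolding P_def N_def using H by (simp_all add: emeasure_density zero)
    then show "measure P (- H) = 0" "measure N H = 0"
      by (simp_all add: measure_def)
  qed
  have U: "upper_variation (charge \<kappa> g) = P"
    by (rule upper_variation_eqI[OF fin' sets' signed _ H null]) (simp add: charge)
  have L: "lower_variation (charge \<kappa> g) = N"
    unfolding lower_variation_def
    by (rule upper_variation_eqI[OF fin'(2,1) sets'(2,1) signed_measure_uminus[OF signed], of "- H"])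
       (use H null in \<open>simp_all add: charge\<close>)
  show "signed_integral (charge \<kappa> g) \<phi> = (LINT x|\<kappa>. g x * \<phi> x)"
    if "\<phi> \<in> borel_measurable borel" "\<And>x. \<bar>\<phi> x\<bar> \<le> B" for \<phi>
    unfolding signed_integral_def U L by (rule int[OF that])
  have "(LINT x|\<kappa>. max 0 (g x)) + (LINT x|\<kappa>. max 0 (- g x)) = (LINT x|\<kappa>. max 0 (g x) + max 0 (- g x))"
    using g by (intro Bochner_Integration.integral_add[symmetric]) auto
  also have "\<dots> = (LINT x|\<kappa>. \<bar>g x\<bar>)"
    by (intro Bochner_Integration.integral_cong) auto
  finally show "total_variation (charge \<kappa> g) = ennreal (LINT x|\<kappa>. \<bar>g x\<bar>)"
    unfolding total_variation_def U L emeasures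
    by (subst ennreal_plus[symmetric]) (auto intro!: Bochner_Integration.integral_nonneg)
qed

section \<open>Recovering a distribution from its mixed derivative\<close>

lemma D_D_apply:
  assumes "\<phi> \<in> test_functions UNIV"
  shows "D_D f \<phi> = f (partial2 (partial1 \<phi>))"
  using assms test_functions_partials[OF assms] by (simp add: D_D_def D_I_def I_D_def)

lemma distributions_outside: "f \<in> distributions \<Longrightarrow> \<phi> \<notin> test_functions UNIV \<Longrightarrow> f \<phi> = 0"
  by (simp add: distributions_def)

lemma distributions_lincomb:
  "f \<in> distributions \<Longrightarrow> \<phi> \<in> test_functions UNIV \<Longrightarrow> \<psi> \<in> test_functions UNIV \<Longrightarrow>
    f (\<lambda>x. a * \<phi> x + b * \<psi> x) = a * f \<phi> + b * f \<psi>"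
  by (simp add: distributions_def)

lemma distributions_diff:
  assumes "f \<in> distributions" "\<phi> \<in> test_functions UNIV" "\<psi> \<in> test_functions UNIV"
  shows "f (\<lambda>x. \<phi> x - \<psi> x) = f \<phi> - f \<psi>"
  using distributions_lincomb[OF assms, of 1 "-1"] by simp

lemma test_functions_diff:
  assumes "\<phi> \<in> test_functions \<Omega>" "\<psi> \<in> test_functions \<Omega>"
  shows "(\<lambda>x. \<phi> x - \<psi> x) \<in> test_functions \<Omega>"
  using test_functions_lincomb[OF assms, of 1 "-1"] by simp

lemma partials_diff:
  assumes "C_k (Suc k) \<phi>" "C_k (Suc k) \<psi>"
  shows "partial2 (\<lambda>x. \<phi> x - \<psi> x) = (\<lambda>x. partial2 \<phi> x - partial2 \<psi> x)"
  using partials_eqI(2)[OF lincomb_has_derivative[OF assms, of 1 "-1"]] by simp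

lemma tsupport_closed_bounded:
  assumes "\<phi> \<in> test_functions \<Omega>"
  shows "closed (tsupport \<phi>)" "bounded (tsupport \<phi>)" "compact (tsupport \<phi>)"
  using assms by (auto simp: test_functions_def compact_eq_bounded_closed)

lemma test_functions_translation:
  assumes "\<phi> \<in> test_functions UNIV" "\<And>x. x \<in> tsupport \<phi> \<Longrightarrow> x + v \<in> \<Omega>"
  shows "(\<lambda>x. \<phi> (x - v)) \<in> test_functions \<Omega>"
proof (rule test_functionsI[of _ "(+) v ` tsupport \<phi>"])
  show "closed ((+) v ` tsupport \<phi>)" "bounded ((+) v ` tsupport \<phi>)"
    using tsupport_closed_bounded[OF assms(1)] by (auto intro: closed_translation bounded_translation)
  show "\<phi> (x - v) = 0" if "x \<notin> (+) v ` tsupport \<phi>" for x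
  proof (rule not_in_tsupport)
    show "x - v \<notin> tsupport \<phi>"
      using that by (metis add_diff_cancel_left' add.commute diff_add_cancel image_eqI)
  qed
qed (use assms in \<open>auto simp: add.commute intro: C_k_translation test_functions_C_k\<close>)

lemma test_functions_segment_integral:
  assumes "\<phi> \<in> test_functions UNIV"
  shows "segment_integral v R \<phi> \<in> test_functions UNIV"
proof -
  define S where "S = (\<lambda>(x, t). x + t *\<^sub>R v) ` (tsupport \<phi> \<times> {0..R})"
  have "compact S"
    unfolding S_def split_beta
    by (intro compact_continuous_image continuous_intros compact_Times tsupport_closed_bounded[OF assms]) auto
  moreover have "segment_integral v R \<phi> x = 0" if "x \<notin> S" for x
  proof -
    have "\<phi> (x - t *\<^sub>R v) = 0" if "t \<in> {0..R}" for t
    proof (rule not_in_tsupport)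
      show "x - t *\<^sub>R v \<notin> tsupport \<phi>"
        using \<open>x \<notin> S\<close> that unfolding S_def
        by (auto simp: image_iff split_beta) (metis diff_add_cancel atLeastAtMost_iff)
    qed
    then have "integral {0..R} (\<lambda>t. \<phi> (x - t *\<^sub>R v)) = integral {0..R} (\<lambda>t. 0)"
      by (intro integral_cong) auto
    then show ?thesis
      by (simp add: segment_integral_def)
  qed
  ultimately show ?thesis
    using assms
    by (intro test_functionsI[of _ S])
       (auto simp: compact_eq_bounded_closed intro: C_k_segment_integral test_functions_C_k)
qed

text \<open>
  The mixed derivative of the double segment integral of \<open>\<psi>\<close> is \<open>\<psi>\<close> plus three signed translates
  of \<open>\<psi>\<close>. If the segments are long enough, the translates are supported off the square, where
  \<open>f\<close> vanishes. So \<open>f\<close> is determined by its mixed derivative.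
\<close>

lemma D_D_recovers:
  assumes f: "f \<in> distributions" and vanish: "\<And>\<phi>. \<phi> \<in> test_functions (- unit_square) \<Longrightarrow> f \<phi> = 0"
    and \<psi>: "\<psi> \<in> test_functions UNIV" and R: "0 \<le> R"
    and far: "\<And>x. x \<in> tsupport \<psi> \<Longrightarrow> 1 < fst x + R \<and> 1 < snd x + R"
  shows "f \<psi> = D_D f (segment_integral (1, 0) R (segment_integral (0, 1) R \<psi>))"
proof -
  let ?g = "segment_integral (0, 1) R \<psi>"
  have g: "?g \<in> test_functions UNIV"
    by (rule test_functions_segment_integral[OF \<psi>])
  have tr: "(\<lambda>x. \<psi> (x - v)) \<in> test_functions (- unit_square)" if "v \<in> {(R, 0), (0, R), (R, R)}" for v
    using far that by (intro test_functions_translation[OF \<psi>]) (fastforce simp: unit_square_def)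
  note tr' = subsetD[OF test_functions_mono[OF subset_UNIV] tr]
  note C = test_functions_C_k[OF \<psi>, of "Suc 0"] test_functions_C_k[OF g, of "Suc 0"]
  have "partial2 (partial1 (segment_integral (1, 0) R ?g)) = partial2 (\<lambda>x. ?g x - ?g (x - (R, 0)))"
    by (simp only: partial1_segment_integral[OF C(2) R])
  also have "\<dots> = (\<lambda>x. partial2 ?g x - partial2 ?g (x - (R, 0)))"
    by (simp only: partials_diff[OF C(2) C_k_translation[OF C(2)]] partial_translation(2)[OF C(2)])
  also have "\<dots> = (\<lambda>x. (\<psi> x - \<psi> (x - (0, R))) - (\<psi> (x - (R, 0)) - \<psi> (x - (R, R))))"
    by (simp add: partial2_segment_integral[OF C(1) R] algebra_simps)
  finally have "D_D f (segment_integral (1, 0) R ?g)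
      = f (\<lambda>x. (\<psi> x - \<psi> (x - (0, R))) - (\<psi> (x - (R, 0)) - \<psi> (x - (R, R))))"
    by (simp add: D_D_apply test_functions_segment_integral[OF g])
  also have "\<dots> = (f \<psi> - f (\<lambda>x. \<psi> (x - (0, R)))) - (f (\<lambda>x. \<psi> (x - (R, 0))) - f (\<lambda>x. \<psi> (x - (R, R))))"
    using \<psi> tr' by (simp add: distributions_diff[OF f] test_functions_diff)
  also have "\<dots> = f \<psi>"
    using tr by (simp add: vanish)
  finally show ?thesis by simp
qed

text \<open>
  The support of a test function is bounded, so one segment length serves both distributions.
\<close>

lemma D_D_determines:
  assumes f: "f \<in> distributions" "\<And>\<phi>. \<phi> \<in> test_functions (- unit_square) \<Longrightarrow> f \<phi> = 0"
    and g: "g \<in> distributions" "\<And>\<phi>. \<phi> \<in> test_functions (- unit_square) \<Longrightarrow> g \<phi> = 0"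
    and eq: "\<And>\<phi>. \<phi> \<in> test_functions UNIV \<Longrightarrow> D_D f \<phi> = D_D g \<phi>"
  shows "f = g"
proof
  fix \<psi>
  show "f \<psi> = g \<psi>"
  proof (cases "\<psi> \<in> test_functions UNIV")
    case True
    obtain B where B: "\<And>x. x \<in> tsupport \<psi> \<Longrightarrow> norm x \<le> B"
      using tsupport_closed_bounded(2)[OF True] by (auto simp: bounded_iff)
    define R where "R = max B 0 + 2"
    have far: "1 < fst x + R \<and> 1 < snd x + R" if "x \<in> tsupport \<psi>" for x
      using B[OF that] norm_fst_le[of "fst x" "snd x"] norm_snd_le[of "snd x" "fst x"] by (auto simp: R_def)
    have "0 \<le> R" by (simp add: R_def)
    then show ?thesis
      using D_D_recovers[OF f True _ far] D_D_recovers[OF g True _ far]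
        eq[OF test_functions_segment_integral[OF test_functions_segment_integral[OF True]]] by simp
  qed (simp add: f g distributions_outside)
qed

section \<open>The grid\<close>

text \<open>
  \<open>knot n k\<close> is the lower left corner of \<open>pixel n k\<close>. With this labelling the weights of the
  derivatives of a pixel image at the knots and edges are the finite differences of the image.
\<close>

definition knot :: "nat \<Rightarrow> int \<times> int \<Rightarrow> plane" where
  "knot n k = (of_int (fst k - 1) / 2 ^ n, of_int (snd k - 1) / 2 ^ n)"

definition knot_indices :: "nat \<Rightarrow> (int \<times> int) set" where
  "knot_indices n = {1..2 ^ n + 1} \<times> {1..2 ^ n + 1}"

lemma finite_indices [simp]: "finite (indices n)" "finite (knot_indices n)"
  by (simp_all add: indices_def knot_indices_def)

lemma pixel_eq_cbox: "pixel n k = cbox (knot n k) (knot n (k + (1, 1)))"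
  by (auto simp: pixel_def knot_def cbox_Pair_eq)

lemma knot_inj: "knot n k = knot n l \<longleftrightarrow> k = l"
  by (auto simp: knot_def prod_eq_iff)

lemma grid_eq_knots: "grid n = knot n ` knot_indices n"
proof (intro set_eqI iffI)
  fix x assume "x \<in> grid n"
  then obtain i j where ij: "x = (real i / 2 ^ n, real j / 2 ^ n)" "i \<le> 2 ^ n" "j \<le> 2 ^ n"
    by (auto simp: grid_def)
  then have "int i \<le> 2 ^ n" "int j \<le> 2 ^ n"
    by (metis of_nat_le_iff of_nat_numeral of_nat_power)+
  with ij show "x \<in> knot n ` knot_indices n"
    by (intro image_eqI[of _ _ "(int i + 1, int j + 1)"]) (auto simp: knot_def knot_indices_def)
next
  fix x assume "x \<in> knot n ` knot_indices n"
  then obtain k where k: "x = knot n k" "k \<in> knot_indices n" by blast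
  then have "nat (fst k - 1) \<le> 2 ^ n" "nat (snd k - 1) \<le> 2 ^ n"
    by (auto simp: knot_indices_def nat_le_iff)
  then show "x \<in> grid n"
    using k unfolding grid_def
    by (intro CollectI exI[of _ "nat (fst k - 1)"] exI[of _ "nat (snd k - 1)"])
       (auto simp: knot_def knot_indices_def)
qed

lemma finite_grid: "finite (grid n)"
  by (simp add: grid_eq_knots)

lemma grid_subset_unit_square: "grid n \<subseteq> unit_square"
proof -
  have "real i / 2 ^ n \<le> 1" if "i \<le> 2 ^ n" for i
    using of_nat_mono[OF that, where 'a = real] by simp
  then show ?thesis
    by (auto simp: grid_def unit_square_def)
qed

lemma pixel_subset_unit_square:
  assumes "k \<in> indices n"
  shows "pixel n k \<subseteq> unit_square"
proof -
  have le: "real_of_int i \<le> 2 ^ n" if "i \<le> 2 ^ n" for i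
    using of_int_le_iff[where 'a = real, THEN iffD2, OF that] by simp
  have "0 \<le> real_of_int (fst k - 1) / 2 ^ n" "0 \<le> real_of_int (snd k - 1) / 2 ^ n"
    "real_of_int (fst k) / 2 ^ n \<le> 1" "real_of_int (snd k) / 2 ^ n \<le> 1"
    using assms le[of "fst k"] le[of "snd k"] by (auto simp: indices_def)
  then show ?thesis
    unfolding pixel_def unit_square_def by (intro Sigma_mono) auto
qed

section \<open>Pixel images and their derivatives\<close>

lemma integral_pixel_eq_LINT:
  assumes "continuous_on UNIV \<phi>"
  shows "integrable lborel (\<lambda>x. indicator (pixel n k) x * \<phi> x :: real)"
    and "(LINT x|lborel. indicator (pixel n k) x * \<phi> x) = integral (pixel n k) \<phi>"
proof -
  have "integrable lborel (\<lambda>x. indicator (pixel n k) x *\<^sub>R \<phi> x)"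
    unfolding pixel_eq_cbox
    by (intro borel_integrable_compact compact_cbox continuous_on_subset[OF assms]) auto
  then show "integrable lborel (\<lambda>x. indicator (pixel n k) x * \<phi> x :: real)"
    and "(LINT x|lborel. indicator (pixel n k) x * \<phi> x) = integral (pixel n k) \<phi>"
    using set_borel_integral_eq_integral(2)[of "pixel n k" \<phi>]
    by (simp_all add: set_integrable_def set_lebesgue_integral_def)
qed

lemma T_star_eq:
  assumes "\<phi> \<in> test_functions UNIV"
  shows "T_star n a \<phi> = (\<Sum>k\<in>indices n. a k * integral (pixel n k) \<phi>)"
proof -
  note int = integral_pixel_eq_LINT[OF test_functions_continuous[OF assms]]
  have "T_star n a \<phi> = (LINT x|lborel. (\<Sum>k\<in>indices n. a k * (indicator (pixel n k) x * \<phi> x)))"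
    using assms by (simp only: T_star_def dist_of_fun_def sum_distrib_right mult.assoc if_True)
  also have "\<dots> = (\<Sum>k\<in>indices n. a k * integral (pixel n k) \<phi>)"
    by (subst Bochner_Integration.integral_sum) (auto simp: int intro!: integrable_mult_right)
  finally show ?thesis .
qed

lemma integrable_on_pixel: "continuous_on UNIV \<phi> \<Longrightarrow> (\<phi> :: plane \<Rightarrow> real) integrable_on pixel n k"
  unfolding pixel_eq_cbox by (rule integrable_continuous, erule continuous_on_subset) simp

lemma T_star_in_distributions: "T_star n a \<in> distributions"
  unfolding distributions_def
proof (intro CollectI conjI allI impI ballI)
  show "T_star n a \<phi> = 0" if "\<phi> \<notin> test_functions UNIV" for \<phi>
    using that by (simp add: T_star_def dist_of_fun_def)
next
  fix \<phi> \<psi> :: "plane \<Rightarrow> real" and b c :: real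
  assume \<phi>: "\<phi> \<in> test_functions UNIV" and \<psi>: "\<psi> \<in> test_functions UNIV"
  have "integral (pixel n k) (\<lambda>x. b * \<phi> x + c * \<psi> x)
      = b * integral (pixel n k) \<phi> + c * integral (pixel n k) \<psi>" for k
    using integrable_on_pixel[OF test_functions_continuous[OF \<phi>], of n k]
      integrable_on_pixel[OF test_functions_continuous[OF \<psi>], of n k]
    by (simp add: integral_add integrable_on_mult_right)
  then show "T_star n a (\<lambda>x. b * \<phi> x + c * \<psi> x) = b * T_star n a \<phi> + c * T_star n a \<psi>"
    by (simp add: T_star_eq test_functions_lincomb \<phi> \<psi> sum.distrib sum_distrib_left algebra_simps)
next
  fix L :: "plane set"
  define C where "C = (\<Sum>k\<in>indices n. \<bar>a k\<bar> * measure lborel (pixel n k))"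
  \<comment> \<open>The order is 0: the supremum of the test function suffices.\<close>
  show "\<exists>C N. \<forall>\<phi>\<in>test_functions UNIV. tsupport \<phi> \<subseteq> L \<longrightarrow>
      \<bar>T_star n a \<phi>\<bar> \<le> C * (\<Sum>i\<le>N. \<Sum>j\<le>N. SUP x. \<bar>(partial1 ^^ i) ((partial2 ^^ j) \<phi>) x\<bar>)"
  proof (intro exI[of _ C] exI[of _ 0] ballI impI)
    fix \<phi> assume \<phi>: "\<phi> \<in> test_functions UNIV"
    define B where "B = (SUP x. \<bar>\<phi> x\<bar>)"
    have "bdd_above (range (\<lambda>x. \<bar>\<phi> x\<bar>))"
      using test_functions_bound[OF \<phi>] by (metis bdd_aboveI2)
    then have B: "\<bar>\<phi> x\<bar> \<le> B" for x
      unfolding B_def by (intro cSUP_upper) auto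
    then have "0 \<le> B"
      using abs_ge_zero order_trans by blast
    have "\<bar>integral (pixel n k) \<phi>\<bar> \<le> measure lborel (pixel n k) * B" for k
      using has_integral_bound[OF \<open>0 \<le> B\<close>, of \<phi> "integral (pixel n k) \<phi>" "knot n k" "knot n (k + (1, 1))"] B
        integrable_integral[OF integrable_on_pixel[OF test_functions_continuous[OF \<phi>], of n k]]
      by (simp add: pixel_eq_cbox mult.commute)
    then have "\<bar>T_star n a \<phi>\<bar> \<le> (\<Sum>k\<in>indices n. \<bar>a k\<bar> * (measure lborel (pixel n k) * B))"
      unfolding T_star_eq[OF \<phi>]
      by (intro order_trans[OF sum_abs] sum_mono) (simp add: abs_mult mult_left_mono)
    then show "\<bar>T_star n a \<phi>\<bar> \<le> C * (\<Sum>i\<le>0. \<Sum>j\<le>0. SUP x. \<bar>(partial1 ^^ i) ((partial2 ^^ j) \<phi>) x\<bar>)"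
      by (simp add: C_def B_def sum_distrib_right mult.assoc)
  qed
qed

lemma T_star_vanishes:
  assumes "\<phi> \<in> test_functions (- unit_square)"
  shows "T_star n a \<phi> = 0"
proof -
  have "\<phi> \<in> test_functions UNIV"
    using assms test_functions_mono by blast
  moreover have "integral (pixel n k) \<phi> = 0" if "k \<in> indices n" for k
  proof -
    have "integral (pixel n k) \<phi> = integral (pixel n k) (\<lambda>x. 0)"
      using test_functions_zero[OF assms] pixel_subset_unit_square[OF that]
      by (intro integral_cong) auto
    then show ?thesis by simp
  qed
  ultimately show ?thesis
    by (simp add: T_star_eq)
qed

lemma T_star_nonneg:
  assumes "a \<in> nonneg_matrices n" "\<phi> \<in> test_functions UNIV" "\<And>x. 0 \<le> \<phi> x"
  shows "0 \<le> T_star n a \<phi>"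
  unfolding T_star_eq[OF assms(2)]
  using assms by (intro sum_nonneg mult_nonneg_nonneg integral_nonneg integrable_on_pixel
      test_functions_continuous) (auto simp: nonneg_matrices_def)

text \<open>
  The integral over the segment of length \<open>w\<close> in the unit direction \<open>v\<close> that starts at a knot. For
  \<open>v = 0\<close> and \<open>w = 1\<close> it is the value at the knot.
\<close>

definition edge_integral :: "nat \<Rightarrow> plane \<Rightarrow> real \<Rightarrow> int \<times> int \<Rightarrow> (plane \<Rightarrow> real) \<Rightarrow> real" where
  "edge_integral n v w k \<phi> = integral {0..w} (\<lambda>t. \<phi> (knot n k + t *\<^sub>R v))"

lemma integral_partial1:
  assumes "C_k (Suc k) \<phi>" "a \<le> b"
  shows "integral {a..b} (\<lambda>s. partial1 \<phi> (s, t)) = \<phi> (b, t) - \<phi> (a, t)"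
proof (rule integral_unique, rule fundamental_theorem_of_calculus[OF assms(2)])
  fix s
  have "((\<lambda>s. (s, t)) has_derivative (\<lambda>h. (h, 0))) (at s within {a..b})"
    by (auto intro!: derivative_eq_intros)
  from has_derivative_compose[OF this C_k_has_derivative[OF assms(1)]]
  show "((\<lambda>s. \<phi> (s, t)) has_vector_derivative partial1 \<phi> (s, t)) (at s within {a..b})"
    by (simp add: has_vector_derivative_def)
qed

lemma integral_partial2:
  assumes "C_k (Suc k) \<phi>" "a \<le> b"
  shows "integral {a..b} (\<lambda>t. partial2 \<phi> (s, t)) = \<phi> (s, b) - \<phi> (s, a)"
proof (rule integral_unique, rule fundamental_theorem_of_calculus[OF assms(2)])
  fix t
  have "((\<lambda>t. (s, t)) has_derivative (\<lambda>h. (0, h))) (at t within {a..b})"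
    by (auto intro!: derivative_eq_intros)
  from has_derivative_compose[OF this C_k_has_derivative[OF assms(1)]]
  show "((\<lambda>t. \<phi> (s, t)) has_vector_derivative partial2 \<phi> (s, t)) (at t within {a..b})"
    by (simp add: has_vector_derivative_def)
qed

lemma integral_box_partial1:
  assumes \<phi>: "C_k (Suc k) \<phi>" and le: "a \<le> b"
  shows "integral (cbox (a, c) (b, d)) (partial1 \<phi>)
    = integral {c..d} (\<lambda>t. \<phi> (b, t)) - integral {c..d} (\<lambda>t. \<phi> (a, t))"
proof -
  have cont: "continuous_on UNIV \<phi>" "continuous_on UNIV (partial1 \<phi>)"
    using \<phi> by (auto intro: C_k_continuous_on[OF \<phi>] C_k_continuous_on)
  note [continuous_intros] = cont[THEN continuous_on_compose2]
  have "integral (cbox (a, c) (b, d)) (partial1 \<phi>)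
      = integral (cbox a b) (\<lambda>s. integral (cbox c d) (\<lambda>t. partial1 \<phi> (s, t)))"
    by (intro integral_prod_continuous continuous_on_subset[OF cont(2)]) auto
  also have "\<dots> = integral (cbox c d) (\<lambda>t. integral (cbox a b) (\<lambda>s. partial1 \<phi> (s, t)))"
    by (rule integral_swap_continuous) (auto simp: split_beta intro!: continuous_intros)
  also have "\<dots> = integral {c..d} (\<lambda>t. \<phi> (b, t) - \<phi> (a, t))"
    by (simp add: integral_partial1[OF \<phi> le])
  also have "\<dots> = integral {c..d} (\<lambda>t. \<phi> (b, t)) - integral {c..d} (\<lambda>t. \<phi> (a, t))"
    by (intro integral_diff integrable_continuous_real continuous_intros) auto
  finally show ?thesis .
qed

lemma integral_box_partial2:
  assumes \<phi>: "C_k (Suc k) \<phi>" and le: "c \<le> d"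
  shows "integral (cbox (a, c) (b, d)) (partial2 \<phi>)
    = integral {a..b} (\<lambda>s. \<phi> (s, d)) - integral {a..b} (\<lambda>s. \<phi> (s, c))"
proof -
  have cont: "continuous_on UNIV \<phi>" "continuous_on UNIV (partial2 \<phi>)"
    using \<phi> by (auto intro: C_k_continuous_on[OF \<phi>] C_k_continuous_on)
  note [continuous_intros] = cont[THEN continuous_on_compose2]
  have "integral (cbox (a, c) (b, d)) (partial2 \<phi>)
      = integral (cbox a b) (\<lambda>s. integral (cbox c d) (\<lambda>t. partial2 \<phi> (s, t)))"
    by (intro integral_prod_continuous continuous_on_subset[OF cont(2)]) auto
  also have "\<dots> = integral {a..b} (\<lambda>s. \<phi> (s, d) - \<phi> (s, c))"
    by (simp add: integral_partial2[OF \<phi> le])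
  also have "\<dots> = integral {a..b} (\<lambda>s. \<phi> (s, d)) - integral {a..b} (\<lambda>s. \<phi> (s, c))"
    by (intro integral_diff integrable_continuous_real continuous_intros) auto
  finally show ?thesis .
qed

lemma integral_shift_origin: "integral {c..c + w} h = integral {0..w} (\<lambda>t. h (c + t :: real) :: real)"
  using integral_shift_Icc_real[of 0 w h c] by (simp add: o_def add.commute)

text \<open>
  By the fundamental theorem of calculus, a first derivative integrates over a pixel to the difference
  of two opposite edges, and the mixed derivative to an alternating sum over the four corners.
\<close>

lemma integral_pixel_partials:
  assumes \<phi>: "\<phi> \<in> test_functions UNIV"
  shows "integral (pixel n k) (partial1 \<phi>)
      = edge_integral n (0, 1) (1 / 2 ^ n) (k + (1, 0)) \<phi> - edge_integral n (0, 1) (1 / 2 ^ n) k \<phi>"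
    and "integral (pixel n k) (partial2 \<phi>)
      = edge_integral n (1, 0) (1 / 2 ^ n) (k + (0, 1)) \<phi> - edge_integral n (1, 0) (1 / 2 ^ n) k \<phi>"
    and "integral (pixel n k) (partial2 (partial1 \<phi>))
      = \<phi> (knot n (k + (1, 1))) - \<phi> (knot n (k + (0, 1))) - \<phi> (knot n (k + (1, 0))) + \<phi> (knot n k)"
proof -
  note C = test_functions_C_k[OF \<phi>, of "Suc 0"]
  obtain i j where k: "k = (i, j)" by (cases k)
  define a c w where "a = real_of_int (i - 1) / 2 ^ n" and "c = real_of_int (j - 1) / 2 ^ n"
    and "w = (1 :: real) / 2 ^ n"
  have w: "0 \<le> w" by (simp add: w_def)
  have kn: "knot n k = (a, c)" "knot n (k + (1, 0)) = (a + w, c)"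
    "knot n (k + (0, 1)) = (a, c + w)" "knot n (k + (1, 1)) = (a + w, c + w)"
    by (simp_all add: knot_def k a_def c_def w_def field_simps)
  have pix: "pixel n k = cbox (a, c) (a + w, c + w)"
    by (simp add: pixel_eq_cbox kn)
  show "integral (pixel n k) (partial1 \<phi>)
      = edge_integral n (0, 1) (1 / 2 ^ n) (k + (1, 0)) \<phi> - edge_integral n (0, 1) (1 / 2 ^ n) k \<phi>"
    unfolding pix w_def[symmetric] edge_integral_def kn
    using w by (simp add: integral_box_partial1[OF C] integral_shift_origin)
  show "integral (pixel n k) (partial2 \<phi>)
      = edge_integral n (1, 0) (1 / 2 ^ n) (k + (0, 1)) \<phi> - edge_integral n (1, 0) (1 / 2 ^ n) k \<phi>"
    unfolding pix w_def[symmetric] edge_integral_def kn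
    using w by (simp add: integral_box_partial2[OF C] integral_shift_origin)
  have C1: "C_k (Suc 0) (partial1 \<phi>)"
    using test_functions_C_k[OF \<phi>, of "Suc (Suc 0)"] by simp
  show "integral (pixel n k) (partial2 (partial1 \<phi>))
      = \<phi> (knot n (k + (1, 1))) - \<phi> (knot n (k + (0, 1))) - \<phi> (knot n (k + (1, 0))) + \<phi> (knot n k)"
    unfolding pix kn
    using w by (simp add: integral_box_partial2[OF C1] integral_partial1[OF C])
qed

text \<open>Summation by parts: the increments of \<open>F\<close> become finite differences of the matrix.\<close>

lemma sum_shift:
  fixes F :: "int \<times> int \<Rightarrow> real"
  assumes "\<And>k. k \<notin> indices n \<Longrightarrow> a k = 0" and "e \<in> {(0, 0), (0, 1), (1, 0), (1, 1)}"
  shows "(\<Sum>k\<in>indices n. a k * F (k + e)) = (\<Sum>k\<in>knot_indices n. a (k - e) * F k)"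
proof -
  have "(\<Sum>k\<in>indices n. a k * F (k + e)) = (\<Sum>k\<in>(\<lambda>k. k + e) ` indices n. a (k - e) * F k)"
    by (subst sum.reindex) (auto simp: inj_on_def)
  also have "\<dots> = (\<Sum>k\<in>knot_indices n. a (k - e) * F k)"
  proof (rule sum.mono_neutral_left)
    show "(\<lambda>k. k + e) ` indices n \<subseteq> knot_indices n"
      using assms(2) by (auto simp: indices_def knot_indices_def)
    show "\<forall>k\<in>knot_indices n - (\<lambda>k. k + e) ` indices n. a (k - e) * F k = 0"
    proof
      fix k assume "k \<in> knot_indices n - (\<lambda>k. k + e) ` indices n"
      then have "k - e \<notin> indices n"
        by (metis DiffD2 diff_add_cancel image_eqI)
      then show "a (k - e) * F k = 0"
        by (simp add: assms(1))
    qed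
  qed simp
  finally show ?thesis .
qed

lemma conv_filter:
  assumes "finite S" "\<And>j. j \<notin> S \<Longrightarrow> h j = 0"
  shows "conv h a k = (\<Sum>j\<in>S. h j * a (k - j))"
proof -
  have "conv h a k = infsum (\<lambda>j. h j * a (k - j)) S"
    unfolding conv_def by (rule infsum_cong_neutral) (use assms in auto)
  then show ?thesis
    using assms(1) by simp
qed

lemma diff_zero_pair: "k - (0, 0) = (k :: int \<times> int)"
  by (cases k) simp

lemma conv_h10: "conv h10 a k = a k - a (k - (1, 0))"
  by (subst conv_filter[of "{(0, 0), (1, 0)}"]) (auto simp: h10_def diff_zero_pair)

lemma conv_h01: "conv h01 a k = a k - a (k - (0, 1))"
  by (subst conv_filter[of "{(0, 0), (0, 1)}"]) (auto simp: h01_def diff_zero_pair)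

lemma conv_h11: "conv h11 a k = a k - a (k - (1, 0)) - a (k - (0, 1)) + a (k - (1, 1))"
  by (subst conv_filter[of "{(0, 0), (0, 1), (1, 0), (1, 1)}"]) (auto simp: h11_def diff_zero_pair)

lemma
  assumes a: "\<And>k. k \<notin> indices n \<Longrightarrow> a k = 0" and \<phi>: "\<phi> \<in> test_functions UNIV"
  shows D_I_T_star: "D_I (T_star n a) \<phi>
      = (\<Sum>k\<in>knot_indices n. conv h10 a k * edge_integral n (0, 1) (1 / 2 ^ n) k \<phi>)"
    and I_D_T_star: "I_D (T_star n a) \<phi>
      = (\<Sum>k\<in>knot_indices n. conv h01 a k * edge_integral n (1, 0) (1 / 2 ^ n) k \<phi>)"
    and D_D_T_star: "D_D (T_star n a) \<phi> = (\<Sum>k\<in>knot_indices n. conv h11 a k * \<phi> (knot n k))"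
proof -
  have shift: "(\<Sum>k\<in>indices n. a k * F (k + e)) = (\<Sum>k\<in>knot_indices n. a (k - e) * F k)"
    if "e \<in> {(0, 0), (0, 1), (1, 0), (1, 1)}" for F :: "int \<times> int \<Rightarrow> real" and e
    by (rule sum_shift[OF a that])
  have shift0: "(\<Sum>k\<in>indices n. a k * F k) = (\<Sum>k\<in>knot_indices n. a k * F k)" for F
    using shift[of "(0, 0)" F] by (simp add: zero_prod_def[symmetric])
  have "D_I (T_star n a) \<phi> = - (\<Sum>k\<in>indices n. a k * integral (pixel n k) (partial1 \<phi>))"
    using \<phi> by (simp add: D_I_def T_star_eq test_functions_partials)
  also have "\<dots> = (\<Sum>k\<in>knot_indices n. conv h10 a k * edge_integral n (0, 1) (1 / 2 ^ n) k \<phi>)"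
    by (simp add: integral_pixel_partials[OF \<phi>] right_diff_distrib sum_subtractf
      shift[of "(1, 0)" "\<lambda>k. edge_integral n (0, 1) (1 / 2 ^ n) k \<phi>"]
      shift0[of "\<lambda>k. edge_integral n (0, 1) (1 / 2 ^ n) k \<phi>"] conv_h10 left_diff_distrib)
  finally show "D_I (T_star n a) \<phi>
      = (\<Sum>k\<in>knot_indices n. conv h10 a k * edge_integral n (0, 1) (1 / 2 ^ n) k \<phi>)" .
  have "I_D (T_star n a) \<phi> = - (\<Sum>k\<in>indices n. a k * integral (pixel n k) (partial2 \<phi>))"
    using \<phi> by (simp add: I_D_def T_star_eq test_functions_partials)
  also have "\<dots> = (\<Sum>k\<in>knot_indices n. conv h01 a k * edge_integral n (1, 0) (1 / 2 ^ n) k \<phi>)"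
    by (simp add: integral_pixel_partials[OF \<phi>] right_diff_distrib sum_subtractf
      shift[of "(0, 1)" "\<lambda>k. edge_integral n (1, 0) (1 / 2 ^ n) k \<phi>"]
      shift0[of "\<lambda>k. edge_integral n (1, 0) (1 / 2 ^ n) k \<phi>"] conv_h01 left_diff_distrib)
  finally show "I_D (T_star n a) \<phi>
      = (\<Sum>k\<in>knot_indices n. conv h01 a k * edge_integral n (1, 0) (1 / 2 ^ n) k \<phi>)" .
  have "D_D (T_star n a) \<phi> = (\<Sum>k\<in>indices n. a k * integral (pixel n k) (partial2 (partial1 \<phi>)))"
    using \<phi> by (simp add: D_D_apply T_star_eq test_functions_partials)
  also have "\<dots> = (\<Sum>k\<in>knot_indices n. conv h11 a k * \<phi> (knot n k))"
    by (simp add: integral_pixel_partials[OF \<phi>] right_diff_distrib distrib_left sum_subtractf sum.distrib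
      shift[of _ "\<lambda>k. \<phi> (knot n k)"] shift0[of "\<lambda>k. \<phi> (knot n k)"] conv_h11 left_diff_distrib distrib_right)
  finally show "D_D (T_star n a) \<phi> = (\<Sum>k\<in>knot_indices n. conv h11 a k * \<phi> (knot n k))" .
qed

lemma l1_norm_conv:
  assumes "\<And>k. k \<notin> indices n \<Longrightarrow> a k = 0" "h \<in> {h10, h01, h11}"
  shows "l1_norm (conv h a) = (\<Sum>k\<in>knot_indices n. \<bar>conv h a k\<bar>)"
proof -
  have "conv h a k = 0" if "k \<notin> knot_indices n" for k
  proof -
    have "k \<notin> indices n" "k - (1, 0) \<notin> indices n" "k - (0, 1) \<notin> indices n" "k - (1, 1) \<notin> indices n"
      using that by (cases k; auto simp: indices_def knot_indices_def)+
    then have "a k = 0" "a (k - (1, 0)) = 0" "a (k - (0, 1)) = 0" "a (k - (1, 1)) = 0"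
      using assms(1) by blast+
    then show ?thesis
      using assms(2) by (auto simp: conv_h10 conv_h01 conv_h11)
  qed
  then have "l1_norm (conv h a) = infsum (\<lambda>k. \<bar>conv h a k\<bar>) (knot_indices n)"
    unfolding l1_norm_def by (intro infsum_cong_neutral) auto
  then show ?thesis by simp
qed

section \<open>Charges on the knots and edges of the grid\<close>

text \<open>
  The two cases of edges and the case of knots are treated alike: \<open>v\<close> is the direction of the
  segments issuing from the knots and \<open>w\<close> their length; \<open>v = 0\<close> collapses them to the knots,
  and then \<open>w = 1\<close> gives each knot unit mass. As the segments are half-open, the knot that a point
  belongs to can be read off by rounding.
\<close>

definition edge_type :: "nat \<Rightarrow> plane \<Rightarrow> real \<Rightarrow> bool" where
  "edge_type n v w \<longleftrightarrow> (v, w) \<in> {((0, 1), 1 / 2 ^ n), ((1, 0), 1 / 2 ^ n), ((0, 0), 1)}"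

definition cell :: "nat \<Rightarrow> plane \<Rightarrow> int \<times> int" where
  "cell n x = (\<lfloor>2 ^ n * fst x\<rfloor> + 1, \<lfloor>2 ^ n * snd x\<rfloor> + 1)"

definition edge_weight :: "nat \<Rightarrow> (int \<times> int \<Rightarrow> real) \<Rightarrow> plane \<Rightarrow> real" where
  "edge_weight n d x = (\<Sum>k\<in>knot_indices n. d k * indicator {x. cell n x = k} x)"

text \<open>
  Arc length on the segments (for \<open>v = 0\<close>, mass \<open>w\<close> at each knot), as the image of the product of the counting measure on the knots
  with Lebesgue measure on the parameter interval. A measure given by weights on the segments thus has
  a density with respect to one positive measure.
\<close>

definition edge_measure :: "nat \<Rightarrow> plane \<Rightarrow> real \<Rightarrow> plane measure" where
  "edge_measure n v w = distr (count_space (knot_indices n) \<Otimes>\<^sub>M restrict_space lborel {0..<w})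
     borel (\<lambda>(k, t). knot n k + t *\<^sub>R v)"

definition edge_charge :: "nat \<Rightarrow> plane \<Rightarrow> real \<Rightarrow> (int \<times> int \<Rightarrow> real) \<Rightarrow> plane set \<Rightarrow> real" where
  "edge_charge n v w d = charge (edge_measure n v w) (edge_weight n d)"

lemma cell_edge:
  assumes "edge_type n v w" "0 \<le> t" "t < w"
  shows "cell n (knot n k + t *\<^sub>R v) = k"
proof -
  have "\<lfloor>2 ^ n * (real_of_int (i - 1) / 2 ^ n + s)\<rfloor> = i - 1" if "0 \<le> s" "s < 1 / 2 ^ n" for i s
    using that by (intro floor_unique) (auto simp: field_simps)
  from this[of t] this[of 0] show ?thesis
    using assms by (cases k) (auto simp: edge_type_def cell_def knot_def)
qed

lemma edge_weight_eq: "edge_weight n d x = (if cell n x \<in> knot_indices n then d (cell n x) else 0)"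
proof -
  have "edge_weight n d x = (\<Sum>k\<in>knot_indices n. if cell n x = k then d k else 0)"
    unfolding edge_weight_def by (intro sum.cong) auto
  then show ?thesis by simp
qed

lemma edge_weight_measurable [measurable]: "edge_weight n d \<in> borel_measurable borel"
proof -
  have "{x. cell n x = k} \<in> sets borel" for k
  proof -
    have "\<lfloor>s\<rfloor> + 1 = i \<longleftrightarrow> real_of_int (i - 1) \<le> s \<and> s < real_of_int i" for s :: real and i
      by linarith
    then have "{x. cell n x = k} = {real_of_int (fst k - 1) / 2 ^ n..<real_of_int (fst k) / 2 ^ n} \<times>
        {real_of_int (snd k - 1) / 2 ^ n..<real_of_int (snd k) / 2 ^ n}"
      by (auto simp: cell_def prod_eq_iff field_simps)
    also have "\<dots> \<in> sets borel"
      by (intro borel_Times) auto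
    finally show ?thesis .
  qed
  then show ?thesis
    unfolding edge_weight_def[abs_def] by measurable
qed

lemma edge_weight_bounded: "\<bar>edge_weight n d x\<bar> \<le> (\<Sum>k\<in>knot_indices n. \<bar>d k\<bar>)"
proof (cases "cell n x \<in> knot_indices n")
  case True
  then have "\<bar>d (cell n x)\<bar> \<le> (\<Sum>k\<in>knot_indices n. \<bar>d k\<bar>)"
    by (intro member_le_sum) auto
  then show ?thesis
    using True by (simp add: edge_weight_eq)
qed (simp add: edge_weight_eq sum_nonneg)

lemma sets_edge_measure [simp, measurable_cong]: "sets (edge_measure n v w) = sets borel"
  by (simp add: edge_measure_def)

lemma edge_map_measurable [measurable]:
  "(\<lambda>(k, t). knot n k + t *\<^sub>R v) \<in> count_space (knot_indices n) \<Otimes>\<^sub>M restrict_space lborel {0..<w} \<rightarrow>\<^sub>M borel"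
proof (rule measurable_pair_measure_countable1)
  show "(\<lambda>t. case (k, t) of (k, t) \<Rightarrow> knot n k + t *\<^sub>R v) \<in> restrict_space lborel {0..<w} \<rightarrow>\<^sub>M borel" for k
    by (intro measurable_restrict_space1) (auto intro!: borel_measurable_continuous_onI continuous_intros)
qed (simp add: countable_finite)

lemma finite_measure_restrict_lborel: "finite_measure (restrict_space lborel {0..<w :: real})"
  by (cases "0 \<le> w"; intro finite_measureI) (simp_all add: space_restrict_space emeasure_restrict_space)

lemma finite_edge_measure: "finite_measure (edge_measure n v w)"
proof -
  have "finite_measure (count_space (knot_indices n) \<Otimes>\<^sub>M restrict_space lborel {0..<w})"
    by (intro finite_measure_pair_measure finite_measure_restrict_lborel finite_measure_count_space) simp
  then show ?thesis
    unfolding edge_measure_def by (intro finite_measure.finite_measure_distr) auto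
qed

lemma integral_edge_measure:
  fixes h :: "plane \<Rightarrow> real"
  assumes [measurable]: "h \<in> borel_measurable borel" and B: "\<And>x. \<bar>h x\<bar> \<le> B"
  shows "(LINT x|edge_measure n v w. h x)
     = (\<Sum>k\<in>knot_indices n. LINT t|restrict_space lborel {0..<w}. h (knot n k + t *\<^sub>R v))"
proof -
  let ?K = "count_space (knot_indices n)" and ?U = "restrict_space lborel {0..<w}"
  interpret K: finite_measure ?K
    by (rule finite_measure_count_space) simp
  interpret U: finite_measure ?U
    by (rule finite_measure_restrict_lborel)
  interpret pair_sigma_finite ?K ?U ..
  have fin: "finite_measure (?K \<Otimes>\<^sub>M ?U)"
    by (intro finite_measure_pair_measure K.finite_measure_axioms U.finite_measure_axioms)
  let ?h = "\<lambda>z. h (case z of (k, t) \<Rightarrow> knot n k + t *\<^sub>R v)"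
  have int: "integrable (?K \<Otimes>\<^sub>M ?U) ?h"
    by (rule finite_measure.integrable_const_bound[OF fin, of _ B]) (use B in auto)
  have "(LINT x|edge_measure n v w. h x) = (LINT z|(?K \<Otimes>\<^sub>M ?U). ?h z)"
    unfolding edge_measure_def by (rule integral_distr) auto
  also have "\<dots> = (LINT k|?K. LINT t|?U. ?h (k, t))"
    by (rule integral_fst'[OF int, symmetric])
  also have "\<dots> = (\<Sum>k\<in>knot_indices n. LINT t|?U. h (knot n k + t *\<^sub>R v))"
    by (simp add: lebesgue_integral_count_space_finite)
  finally show ?thesis .
qed

lemma integral_edge_weight:
  fixes \<phi> :: "plane \<Rightarrow> real"
  assumes type: "edge_type n v w"
    and [measurable]: "\<phi> \<in> borel_measurable borel" and B: "\<And>x. \<bar>\<phi> x\<bar> \<le> B"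
  shows "(LINT x|edge_measure n v w. edge_weight n d x * \<phi> x)
    = (\<Sum>k\<in>knot_indices n. d k * (LINT t|restrict_space lborel {0..<w}. \<phi> (knot n k + t *\<^sub>R v)))"
proof -
  have "(LINT x|edge_measure n v w. edge_weight n d x * \<phi> x)
     = (\<Sum>k\<in>knot_indices n. LINT t|restrict_space lborel {0..<w}.
         edge_weight n d (knot n k + t *\<^sub>R v) * \<phi> (knot n k + t *\<^sub>R v))"
  proof (rule integral_edge_measure)
    show "\<bar>edge_weight n d x * \<phi> x\<bar> \<le> (\<Sum>k\<in>knot_indices n. \<bar>d k\<bar>) * B" for x
      unfolding abs_mult by (intro mult_mono edge_weight_bounded B sum_nonneg) auto
  qed measurable
  also have "\<dots> = (\<Sum>k\<in>knot_indices n. LINT t|restrict_space lborel {0..<w}.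
         d k * \<phi> (knot n k + t *\<^sub>R v))"
    by (intro sum.cong Bochner_Integration.integral_cong refl)
       (simp add: edge_weight_eq space_restrict_space cell_edge[OF type])
  finally show ?thesis by simp
qed

lemma integrable_edge_weight: "integrable (edge_measure n v w) (edge_weight n d)"
  by (rule finite_measure.integrable_const_bound[OF finite_edge_measure, of _ "\<Sum>k\<in>knot_indices n. \<bar>d k\<bar>"])
     (use edge_weight_bounded in auto)

lemma signed_measure_edge_charge: "signed_measure (edge_charge n v w d)"
  unfolding edge_charge_def
  by (intro signed_measure_charge finite_edge_measure integrable_edge_weight) simp

lemma LINT_restrict_eq_edge_integral:
  assumes "continuous_on UNIV \<phi>"
  shows "(LINT t|restrict_space lborel {0..<w}. \<phi> (knot n k + t *\<^sub>R v)) = edge_integral n v w k \<phi>"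
proof -
  let ?h = "\<lambda>t. \<phi> (knot n k + t *\<^sub>R v)"
  have "continuous_on {0..w} ?h"
    by (intro continuous_on_compose2[OF assms] continuous_intros) auto
  then have "set_integrable lborel {0..<w} ?h"
    by (rule set_integrable_subset[OF borel_integrable_atLeastAtMost']) auto
  then have "(LINT t|restrict_space lborel {0..<w}. ?h t) = integral {0..<w} ?h"
    using set_borel_integral_eq_integral(2)[of "{0..<w}" ?h]
    by (simp add: integral_restrict_space set_lebesgue_integral_def)
  also have "\<dots> = integral {0..w} ?h"
  proof (rule integral_subset_negligible)
    have "{0..w} - {0..<w} \<subseteq> {w}" by auto
    then show "negligible ({0..w} - {0..<w})"
      using negligible_subset negligible_sing by blast
  qed auto
  finally show ?thesis
    by (simp add: edge_integral_def)
qed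

lemma signed_integral_edge_charge:
  assumes "edge_type n v w" "\<phi> \<in> test_functions UNIV"
  shows "signed_integral (edge_charge n v w d) \<phi> = (\<Sum>k\<in>knot_indices n. d k * edge_integral n v w k \<phi>)"
proof -
  obtain B where B: "\<And>x. \<bar>\<phi> x\<bar> \<le> B"
    using test_functions_bound[OF assms(2)] by blast
  have meas: "\<phi> \<in> borel_measurable borel"
    by (rule test_functions_measurable[OF assms(2)])
  show ?thesis
    unfolding edge_charge_def
    using signed_integral_charge[OF finite_edge_measure sets_edge_measure integrable_edge_weight meas B]
      integral_edge_weight[OF assms(1) meas B]
    by (simp add: LINT_restrict_eq_edge_integral test_functions_continuous[OF assms(2)])
qed

lemma total_variation_edge_charge:
  assumes "edge_type n v w"
  shows "total_variation (edge_charge n v w d) = ennreal (w * (\<Sum>k\<in>knot_indices n. \<bar>d k\<bar>))"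
proof -
  have w: "0 \<le> w"
    using assms by (auto simp: edge_type_def)
  have "(LINT x|edge_measure n v w. \<bar>edge_weight n d x\<bar>)
      = (LINT x|edge_measure n v w. edge_weight n (\<lambda>k. \<bar>d k\<bar>) x * 1)"
    by (intro Bochner_Integration.integral_cong) (auto simp: edge_weight_eq)
  also have "\<dots> = (\<Sum>k\<in>knot_indices n. \<bar>d k\<bar> * (LINT t|restrict_space lborel {0..<w}. 1))"
    by (intro integral_edge_weight[OF assms, of _ 1]) auto
  also have "\<dots> = w * (\<Sum>k\<in>knot_indices n. \<bar>d k\<bar>)"
    using w by (simp add: measure_restrict_space space_restrict_space sum_distrib_left mult.commute)
  finally show ?thesis
    unfolding edge_charge_def
    using total_variation_charge[OF finite_edge_measure sets_edge_measure integrable_edge_weight, of n v w d]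
    by simp
qed

lemma edge_charge_knots:
  assumes "A \<in> sets borel"
  shows "edge_charge n 0 1 d A = (\<Sum>k\<in>knot_indices n. d k * indicator A (knot n k))"
proof -
  have "edge_type n 0 1"
    by (simp add: edge_type_def zero_prod_def)
  moreover have "\<bar>indicator A x\<bar> \<le> (1 :: real)" for x :: plane
    by (simp add: indicator_def)
  ultimately have "(LINT x|edge_measure n 0 1. edge_weight n d x * indicator A x)
      = (\<Sum>k\<in>knot_indices n. d k * (LINT t|restrict_space lborel {0..<1::real}. indicator A (knot n k + t *\<^sub>R 0)))"
    using assms by (intro integral_edge_weight[where B = 1]) auto
  also have "\<dots> = (\<Sum>k\<in>knot_indices n. d k * indicator A (knot n k))"
    by (simp add: measure_restrict_space space_restrict_space)
  finally show ?thesis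
    using assms by (simp add: edge_charge_def charge_def)
qed

lemma supported_in_edge_charge_knots: "supported_in (grid n) (edge_charge n 0 1 d)"
  unfolding supported_in_def
proof (intro ballI impI)
  fix A :: "plane set" assume A: "A \<in> sets borel" "A \<inter> grid n = {}"
  then have "knot n k \<notin> A" if "k \<in> knot_indices n" for k
    using that by (auto simp: grid_eq_knots)
  then show "edge_charge n 0 1 d A = 0"
    by (simp add: edge_charge_knots[OF A(1)])
qed

lemma edge_integral_knots: "edge_integral n 0 1 k \<phi> = \<phi> (knot n k)"
  by (simp add: edge_integral_def)

lemma signed_measure_finite_set:
  assumes "signed_measure \<mu>" "finite F"
  shows "\<mu> F = (\<Sum>x\<in>F. \<mu> {x})"
  using assms(2)
proof (induction F)
  case (insert x F)
  then show ?case
    using signed_measure_Un[OF assms(1), of "{x}" F] by (auto simp: finite_imp_closed)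
qed (simp add: signed_measure_empty[OF assms(1)])

text \<open>Finite additivity on the grid reduces the measure to its values at single knots.\<close>

lemma supported_in_grid_eq_edge_charge:
  assumes \<mu>: "signed_measure \<mu>" and supp: "supported_in (grid n) \<mu>"
  shows "\<mu> = edge_charge n 0 1 (\<lambda>k. \<mu> {knot n k})"
proof (rule signed_measure_eqI[OF \<mu> signed_measure_edge_charge])
  fix p q :: plane
  let ?A = "box p q"
  have fin: "finite (?A \<inter> grid n)"
    using finite_grid by auto
  then have sets: "?A \<inter> grid n \<in> sets borel" "?A - grid n \<in> sets borel"
    using finite_grid by (auto simp: finite_imp_closed)
  have "?A \<inter> grid n \<union> (?A - grid n) = ?A" "?A \<inter> grid n \<inter> (?A - grid n) = {}"
    by auto
  then have "\<mu> ?A = \<mu> (?A \<inter> grid n) + \<mu> (?A - grid n)"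
    using signed_measure_Un[OF \<mu> sets] by simp
  also have "\<mu> (?A - grid n) = 0"
    using supp sets(2) unfolding supported_in_def by blast
  also have "\<mu> (?A \<inter> grid n) = (\<Sum>x\<in>?A \<inter> grid n. \<mu> {x})"
    by (rule signed_measure_finite_set[OF \<mu> fin])
  also have "\<dots> = (\<Sum>x\<in>grid n. \<mu> {x} * indicator ?A x)"
    using finite_grid by (intro sum.mono_neutral_cong_left) (auto simp: indicator_def)
  also have "\<dots> = (\<Sum>k\<in>knot_indices n. \<mu> {knot n k} * indicator ?A (knot n k))"
    unfolding grid_eq_knots by (subst sum.reindex) (auto simp: inj_on_def knot_inj)
  finally show "\<mu> ?A = edge_charge n 0 1 (\<lambda>k. \<mu> {knot n k}) ?A"
    by (simp add: edge_charge_knots)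
qed

section \<open>The norm of a pixel image\<close>

lemma dist_of_measure_edge_charge:
  assumes "edge_type n v w" "\<And>\<phi>. \<phi> \<notin> test_functions UNIV \<Longrightarrow> g \<phi> = 0"
    and "\<And>\<phi>. \<phi> \<in> test_functions UNIV \<Longrightarrow> g \<phi> = (\<Sum>k\<in>knot_indices n. d k * edge_integral n v w k \<phi>)"
  shows "g = dist_of_measure (edge_charge n v w d)"
  using assms by (auto simp: dist_of_measure_def signed_integral_edge_charge)

lemma
  assumes "\<And>k. k \<notin> indices n \<Longrightarrow> a k = 0"
  shows D_D_T_star_charge: "D_D (T_star n a) = dist_of_measure (edge_charge n 0 1 (conv h11 a))"
    and D_I_T_star_charge: "D_I (T_star n a) = dist_of_measure (edge_charge n (0, 1) (1 / 2 ^ n) (conv h10 a))"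
    and I_D_T_star_charge: "I_D (T_star n a) = dist_of_measure (edge_charge n (1, 0) (1 / 2 ^ n) (conv h01 a))"
proof -
  have type: "edge_type n 0 1" "edge_type n (0, 1) (1 / 2 ^ n)" "edge_type n (1, 0) (1 / 2 ^ n)"
    by (simp_all add: edge_type_def zero_prod_def)
  show "D_D (T_star n a) = dist_of_measure (edge_charge n 0 1 (conv h11 a))"
    by (rule dist_of_measure_edge_charge[OF type(1)])
       (simp add: D_D_def D_I_def, simp add: D_D_T_star[OF assms] edge_integral_knots)
  show "D_I (T_star n a) = dist_of_measure (edge_charge n (0, 1) (1 / 2 ^ n) (conv h10 a))"
    by (rule dist_of_measure_edge_charge[OF type(2) _ D_I_T_star[OF assms]]) (simp add: D_I_def)
  show "I_D (T_star n a) = dist_of_measure (edge_charge n (1, 0) (1 / 2 ^ n) (conv h01 a))"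
    by (rule dist_of_measure_edge_charge[OF type(3) _ I_D_T_star[OF assms]]) (simp add: I_D_def)
qed

lemma theta_norm_T_star:
  assumes a: "\<And>k. k \<notin> indices n \<Longrightarrow> a k = 0" and "0 \<le> \<theta>" "\<theta> \<le> 1"
  shows "theta_norm \<theta> (T_star n a) = ennreal (discrete_theta_norm n \<theta> a)"
proof -
  have norm: "M_norm (dist_of_measure (edge_charge n v w (conv h a))) = ennreal (w * l1_norm (conv h a))"
    if "edge_type n v w" "h \<in> {h10, h01, h11}" for v w h
    by (simp add: M_norm_dist_of_measure signed_measure_edge_charge total_variation_edge_charge[OF that(1)]
        l1_norm_conv[OF a that(2)])
  have nonneg: "0 \<le> l1_norm (conv h a)" for h
    unfolding l1_norm_def by (intro infsum_nonneg) auto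
  have "M_norm (D_D (T_star n a)) = ennreal (l1_norm (conv h11 a))"
    "M_norm (D_I (T_star n a)) = ennreal (1 / 2 ^ n * l1_norm (conv h10 a))"
    "M_norm (I_D (T_star n a)) = ennreal (1 / 2 ^ n * l1_norm (conv h01 a))"
    using norm[of 0 1 h11] norm[of "(0, 1)" "1 / 2 ^ n" h10] norm[of "(1, 0)" "1 / 2 ^ n" h01]
    by (simp_all add: D_D_T_star_charge[OF a] D_I_T_star_charge[OF a] I_D_T_star_charge[OF a]
        edge_type_def zero_prod_def)
  then have "theta_norm \<theta> (T_star n a) = ennreal \<theta> * ennreal (l1_norm (conv h11 a))
      + ennreal (1 - \<theta>) * (ennreal (1 / 2 ^ n * l1_norm (conv h01 a)) + ennreal (1 / 2 ^ n * l1_norm (conv h10 a)))"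
    by (simp only: theta_norm_def grad_norm_def)
  also have "\<dots> = ennreal (\<theta> * l1_norm (conv h11 a)
      + (1 - \<theta>) * (1 / 2 ^ n * l1_norm (conv h01 a) + 1 / 2 ^ n * l1_norm (conv h10 a)))"
    using assms(2,3) nonneg by (simp only: ennreal_mult[symmetric] ennreal_plus[symmetric]
        add_nonneg_nonneg mult_nonneg_nonneg zero_le_divide_1_iff zero_le_power diff_ge_0_iff_ge zero_le_numeral)
  also have "\<theta> * l1_norm (conv h11 a)
      + (1 - \<theta>) * (1 / 2 ^ n * l1_norm (conv h01 a) + 1 / 2 ^ n * l1_norm (conv h10 a)) = discrete_theta_norm n \<theta> a"
    by (simp add: discrete_theta_norm_def algebra_simps add_divide_distrib diff_divide_distrib)
  finally show ?thesis .
qed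

section \<open>Pixel images are the elements of the discretized space\<close>

lemma nonneg_matrices_outside: "a \<in> nonneg_matrices n \<Longrightarrow> k \<notin> indices n \<Longrightarrow> a k = 0"
  unfolding nonneg_matrices_def by blast

lemma T_star_in_grid_space:
  assumes a: "a \<in> nonneg_matrices n"
  shows "T_star n a \<in> M_DD0_pos_grid n"
proof -
  let ?\<mu> = "edge_charge n 0 1 (conv h11 a)"
  have eq: "D_D (T_star n a) = dist_of_measure ?\<mu>"
    by (rule D_D_T_star_charge[OF nonneg_matrices_outside[OF a]])
  have "supported_in unit_square ?\<mu>"
    using supported_in_edge_charge_knots grid_subset_unit_square[of n] unfolding supported_in_def by blast
  then have "D_D (T_star n a) \<in> measures_in unit_square" "D_D (T_star n a) \<in> measures_in (grid n)"
    unfolding eq measures_in_def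
    using signed_measure_edge_charge supported_in_edge_charge_knots by auto
  moreover have "\<forall>\<phi>\<in>test_functions UNIV. (\<forall>x. 0 \<le> \<phi> x) \<longrightarrow> 0 \<le> T_star n a \<phi>"
    using T_star_nonneg[OF a] by blast
  ultimately show ?thesis
    using T_star_in_distributions T_star_vanishes
    by (simp add: M_DD0_pos_grid_def M_DD0_pos_def M_DD0_def del: split_paired_All)
qed

lemma integral_bump_pos:
  assumes "r > 0" "\<alpha> < \<beta>"
  shows "0 < integral {\<alpha>..\<beta>} (bump r \<alpha> \<beta>)"
proof -
  have "integral {\<alpha>..\<beta>} (\<lambda>_. 0) < integral {\<alpha>..\<beta>} (bump r \<alpha> \<beta>)"
    using assms continuous_on_subset[OF continuous_on_bump]
    by (intro integral_less_real) (auto simp: bump_pos_iff)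
  then show ?thesis by simp
qed

lemma integral_bump_before:
  assumes "r > 0" "c \<le> \<alpha>"
  shows "integral {0..R} (\<lambda>s. bump r \<alpha> \<beta> (c - s)) = 0"
proof -
  have "integral {0..R} (\<lambda>s. bump r \<alpha> \<beta> (c - s)) = integral {0..R} (\<lambda>s. 0)"
    using assms by (intro integral_cong) (auto simp: bump_eq_0_iff)
  then show ?thesis by simp
qed

lemma integral_bump_after:
  assumes "r > 0" "\<beta> \<le> c" "c - R \<le> \<alpha>"
  shows "integral {0..R} (\<lambda>s. bump r \<alpha> \<beta> (c - s)) = integral {\<alpha>..\<beta>} (bump r \<alpha> \<beta>)"
proof -
  have "integral {0..R} (\<lambda>s. bump r \<alpha> \<beta> (c - s)) = integral {- R..0} (\<lambda>s. bump r \<alpha> \<beta> (c + s))"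
    using Henstock_Kurzweil_Integration.integral_reflect_real[of R 0 "\<lambda>s. bump r \<alpha> \<beta> (c - s)"]
    by (simp only: minus_zero diff_minus_eq_add)
  also have "\<dots> = integral {c - R..c} (bump r \<alpha> \<beta>)"
    using integral_shift_Icc_real[of "- R" 0 "bump r \<alpha> \<beta>" c] by (simp add: o_def)
  also have "\<dots> = integral {\<alpha>..\<beta>} (bump r \<alpha> \<beta>)"
  proof (rule integral_unique, rule has_integral_on_superset)
    show "(bump r \<alpha> \<beta> has_integral integral {\<alpha>..\<beta>} (bump r \<alpha> \<beta>)) {\<alpha>..\<beta>}"
      by (intro integrable_integral integrable_continuous_real continuous_on_subset[OF continuous_on_bump]) auto
  qed (use assms in \<open>auto simp: bump_eq_0_iff\<close>)
  finally show ?thesis .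
qed

lemma segment_integrals_box_bump:
  "segment_integral (1, 0) R (segment_integral (0, 1) R (box_bump r p q)) x =
    integral {0..R} (\<lambda>s. bump r (fst p) (fst q) (fst x - s)) *
    integral {0..R} (\<lambda>t. bump r (snd p) (snd q) (snd x - t))"
  by (simp add: segment_integral_def box_bump_def)

text \<open>
  The value of the double segment integral of a bump inside pixel \<open>k\<close> at a knot \<open>l\<close> is the
  same positive constant for all knots to the upper right of the pixel, and 0 for all other
  knots. So pairing \<open>f\<close> with such a bump measures the mass of the mixed derivative to the
  upper right of the pixel.
\<close>

lemma pixel_test_function:
  assumes f: "f \<in> distributions" "\<And>\<phi>. \<phi> \<in> test_functions (- unit_square) \<Longrightarrow> f \<phi> = 0"
    and DD: "\<And>\<phi>. \<phi> \<in> test_functions UNIV \<Longrightarrow> D_D f \<phi> = (\<Sum>l\<in>knot_indices n. m l * \<phi> (knot n l))"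
  shows "\<exists>\<psi> C. \<psi> \<in> test_functions UNIV \<and> (\<forall>x. 0 \<le> \<psi> x) \<and> 0 < C \<and>
    f \<psi> = C * (\<Sum>l\<in>knot_indices n. if fst k < fst l \<and> snd k < snd l then m l else 0) \<and>
    (k \<notin> indices n \<longrightarrow> \<psi> \<in> test_functions (- unit_square))"
proof -
  define N :: real where "N = 2 ^ n"
  have N: "N \<ge> 1" by (simp add: N_def)
  obtain i j where k: "k = (i, j)" by (cases k)
  define lo hi where "lo i = (real_of_int i - 2 / 3) / N" and "hi i = (real_of_int i - 1 / 3) / N" for i
  \<comment> \<open>The bump sits in the middle third of the pixel, so that its closed support stays off the square
    if the pixel lies outside.\<close>
  define p q where "p = (lo i, lo j)" and "q = (hi i, hi j)"
  define \<psi> where "\<psi> = box_bump 1 p q"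
  \<comment> \<open>Segments of length \<open>R\<close> reach from every knot back across the bump, and push the support of the
    bump beyond the square.\<close>
  define R where "R = 2 + \<bar>lo i\<bar> + \<bar>lo j\<bar>"
  define C where "C = integral {lo i..hi i} (bump 1 (lo i) (hi i)) * integral {lo j..hi j} (bump 1 (lo j) (hi j))"
  have lohi: "lo i < hi i" for i
    using N by (simp add: lo_def hi_def divide_strict_right_mono)
  have \<psi>: "\<psi> \<in> test_functions UNIV"
    unfolding \<psi>_def by (rule box_bump_in_test_functions) auto
  moreover have "0 \<le> \<psi> x" for x
    by (simp add: \<psi>_def box_bump_bounds)
  moreover have "0 < C"
    unfolding C_def using integral_bump_pos[OF _ lohi] by simp
  moreover have "f \<psi> = C * (\<Sum>l\<in>knot_indices n. if fst k < fst l \<and> snd k < snd l then m l else 0)"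
  proof -
    have factor: "integral {0..R} (\<lambda>s. bump 1 (lo i') (hi i') (real_of_int (l - 1) / N - s)) =
        (if i' < l then integral {lo i'..hi i'} (bump 1 (lo i') (hi i')) else 0)"
      if "l \<le> 2 ^ n + 1" "1 - R \<le> lo i'" for l i'
    proof (cases "i' < l")
      case True
      have "real_of_int (l - 1) \<le> real_of_int (2 ^ n)"
        using that(1) by (simp only: of_int_le_iff)
      then have "real_of_int (l - 1) / N \<le> 1"
        using N by (simp add: N_def)
      moreover have "hi i' \<le> real_of_int (l - 1) / N"
        using True N by (simp add: hi_def divide_right_mono)
      ultimately show ?thesis
        using True that(2) by (simp add: integral_bump_after)
    next
      case False
      then have "real_of_int (l - 1) / N \<le> lo i'"
        using N by (simp add: lo_def divide_right_mono)
      then show ?thesis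
        using False by (simp add: integral_bump_before)
    qed
    have far: "1 < fst x + R \<and> 1 < snd x + R" if "x \<in> tsupport \<psi>" for x
    proof -
      have "tsupport \<psi> \<subseteq> cbox p q"
        unfolding tsupport_def
      proof (rule closure_minimal)
        show "{x. \<psi> x \<noteq> 0} \<subseteq> cbox p q"
          using box_bump_eq_0[of 1 _ p q] box_subset_cbox[of p q] by (auto simp: \<psi>_def)
      qed (rule closed_cbox)
      then have "x \<in> cbox p q"
        using that by blast
      then show ?thesis
        by (auto simp: mem_cbox_plane p_def R_def)
    qed
    have "0 \<le> R" by (simp add: R_def)
    have "f \<psi> = D_D f (segment_integral (1, 0) R (segment_integral (0, 1) R \<psi>))"
      by (rule D_D_recovers[OF f \<psi> \<open>0 \<le> R\<close> far])
    also have "\<dots> = (\<Sum>l\<in>knot_indices n. m l * segment_integral (1, 0) R (segment_integral (0, 1) R \<psi>) (knot n l))"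
      by (intro DD test_functions_segment_integral \<psi>)
    also have "\<dots> = (\<Sum>l\<in>knot_indices n. C * (if fst k < fst l \<and> snd k < snd l then m l else 0))"
    proof (rule sum.cong)
      fix l assume "l \<in> knot_indices n"
      then have l: "fst l \<le> 2 ^ n + 1" "snd l \<le> 2 ^ n + 1"
        by (auto simp: knot_indices_def)
      have R: "1 - R \<le> lo i" "1 - R \<le> lo j"
        by (auto simp: R_def)
      show "m l * segment_integral (1, 0) R (segment_integral (0, 1) R \<psi>) (knot n l)
          = C * (if fst k < fst l \<and> snd k < snd l then m l else 0)"
        unfolding \<psi>_def segment_integrals_box_bump
        using factor[OF l(1) R(1)] factor[OF l(2) R(2)]
        by (simp add: p_def q_def knot_def N_def[symmetric] k C_def)
    qed simp
    finally show ?thesis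
      by (simp add: sum_distrib_left)
  qed
  moreover have "\<psi> \<in> test_functions (- unit_square)" if "k \<notin> indices n"
    unfolding \<psi>_def
  proof (rule box_bump_in_test_functions)
    have out: "hi i' < 0 \<or> 1 < lo i'" if "\<not> (1 \<le> i' \<and> i' \<le> 2 ^ n)" for i'
    proof (cases "1 \<le> i'")
      case False
      then show ?thesis
        using N by (auto simp: hi_def divide_less_0_iff)
    next
      case True
      then have "2 ^ n + 1 \<le> i'"
        using that by auto
      then have "real_of_int (2 ^ n + 1) \<le> real_of_int i'"
        by (simp only: of_int_le_iff)
      then show ?thesis
        using N by (simp add: lo_def less_divide_eq N_def)
    qed
    then have "(hi i < 0 \<or> 1 < lo i) \<or> (hi j < 0 \<or> 1 < lo j)"
      using \<open>k \<notin> indices n\<close> by (auto simp: indices_def k)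
    then show "cbox p q \<subseteq> - unit_square"
      by (auto simp: p_def q_def unit_square_def)
  qed simp
  ultimately show ?thesis
    by blast
qed

text \<open>
  Inclusion and exclusion over the four quadrants with corners around \<open>k\<close> isolates the mass at \<open>k\<close>.
\<close>

lemma conv_h11_upper_sum:
  assumes "finite K" "k \<in> K"
  shows "conv h11 (\<lambda>k. \<Sum>l\<in>K. if fst k < fst l \<and> snd k < snd l then m l else 0) k = m k"
proof -
  obtain i j where k: "k = (i, j)" by (cases k)
  have *: "(if i < fst l \<and> j < snd l then m l else 0) - (if i - 1 < fst l \<and> j < snd l then m l else 0)
      - (if i < fst l \<and> j - 1 < snd l then m l else 0) + (if i - 1 < fst l \<and> j - 1 < snd l then m l else 0)
      = (if k = l then m l else 0)" for l
    by (cases l; cases "i = fst l"; cases "j = snd l") (auto simp: k)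
  have "conv h11 (\<lambda>k. \<Sum>l\<in>K. if fst k < fst l \<and> snd k < snd l then m l else 0) k
      = (\<Sum>l\<in>K. if k = l then m l else 0)"
    unfolding conv_h11 sum_subtractf[symmetric] sum.distrib[symmetric]
  proof (intro sum.cong refl)
    fix l
    show "(if fst k < fst l \<and> snd k < snd l then m l else 0)
        - (if fst (k - (1, 0)) < fst l \<and> snd (k - (1, 0)) < snd l then m l else 0)
        - (if fst (k - (0, 1)) < fst l \<and> snd (k - (0, 1)) < snd l then m l else 0)
        + (if fst (k - (1, 1)) < fst l \<and> snd (k - (1, 1)) < snd l then m l else 0)
        = (if k = l then m l else 0)"
      using *[of l] by (simp add: k)
  qed
  then show ?thesis
    using assms by simp
qed

lemma grid_space_is_T_star:
  assumes f: "f \<in> M_DD0_pos_grid n"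
  obtains a where "a \<in> nonneg_matrices n" "f = T_star n a"
proof -
  have mem: "f \<in> M_DD0" "f \<in> M_DD0_pos" "D_D f \<in> measures_in (grid n)"
    using f by (simp_all add: M_DD0_pos_grid_def M_DD0_pos_def)
  have dist: "f \<in> distributions"
    using mem(1) by (simp add: M_DD0_def)
  have van: "f \<phi> = 0" if "\<phi> \<in> test_functions (- unit_square)" for \<phi>
    using mem(1) that by (simp add: M_DD0_def)
  have pos: "0 \<le> f \<phi>" if "\<phi> \<in> test_functions UNIV" "\<And>x. 0 \<le> \<phi> x" for \<phi>
    using mem(2) that by (simp add: M_DD0_pos_def)
  obtain \<mu> where \<mu>: "signed_measure \<mu>" "supported_in (grid n) \<mu>" "D_D f = dist_of_measure \<mu>"
    using mem(3) unfolding measures_in_def by blast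
  define m where "m k = \<mu> {knot n k}" for k
  have type: "edge_type n 0 1"
    by (simp add: edge_type_def zero_prod_def)
  have "\<mu> = edge_charge n 0 1 m"
    unfolding m_def[abs_def] by (rule supported_in_grid_eq_edge_charge[OF \<mu>(1,2)])
  then have "D_D f = dist_of_measure (edge_charge n 0 1 m)"
    using \<mu>(3) by simp
  then have DD: "D_D f \<phi> = (\<Sum>l\<in>knot_indices n. m l * \<phi> (knot n l))" if "\<phi> \<in> test_functions UNIV" for \<phi>
    using that signed_integral_edge_charge[OF type that, of m]
    by (simp add: dist_of_measure_def edge_integral_knots)
  define a where "a k = (\<Sum>l\<in>knot_indices n. if fst k < fst l \<and> snd k < snd l then m l else 0)" for k
  have tests: "\<exists>\<psi> C. \<psi> \<in> test_functions UNIV \<and> (\<forall>x. 0 \<le> \<psi> x) \<and> 0 < C \<and> f \<psi> = C * a k \<and>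
      (k \<notin> indices n \<longrightarrow> \<psi> \<in> test_functions (- unit_square))" for k
    unfolding a_def by (rule pixel_test_function[OF dist van DD])
  have outside: "a k = 0" if k: "k \<notin> indices n" for k
  proof -
    obtain \<psi> C where "0 < C" "f \<psi> = C * a k" "\<psi> \<in> test_functions (- unit_square)"
      using tests[of k] k by blast
    then show ?thesis
      using van by simp
  qed
  moreover have "0 \<le> a k" for k
  proof -
    obtain \<psi> C where "\<psi> \<in> test_functions UNIV" "\<And>x. 0 \<le> \<psi> x" "0 < C" "f \<psi> = C * a k"
      using tests[of k] by blast
    then show ?thesis
      using pos[of \<psi>] by (simp add: zero_le_mult_iff)
  qed
  ultimately have "a \<in> nonneg_matrices n"
    by (auto simp: nonneg_matrices_def)
  moreover have "f = T_star n a"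
  proof (rule D_D_determines[OF dist van T_star_in_distributions T_star_vanishes])
    have "conv h11 a k = m k" if "k \<in> knot_indices n" for k
      using conv_h11_upper_sum[OF finite_indices(2) that] unfolding a_def[abs_def] .
    moreover have "D_D (T_star n a) \<phi> = (\<Sum>k\<in>knot_indices n. conv h11 a k * \<phi> (knot n k))"
      if "\<phi> \<in> test_functions UNIV" for \<phi>
      by (rule D_D_T_star[OF outside that])
    ultimately show "D_D f \<phi> = D_D (T_star n a) \<phi>" if "\<phi> \<in> test_functions UNIV" for \<phi>
      using that by (simp add: DD)
  qed
  ultimately show ?thesis
    by (rule that)
qed

section \<open>Reading off the pixel values\<close>

text \<open>
  The bumps are bounded by the indicator of the closed box, on which \<open>u\<close> is integrable, so dominated
  convergence applies.
\<close>

lemma locally_integrable_box_bump_tendsto: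
  assumes u: "locally_integrable u"
  shows "(\<lambda>n. LINT x|lborel. u x * box_bump (real (Suc n)) p q x)
     \<longlonglongrightarrow> (LINT x|lborel. u x * indicator (box p q) x)"
proof -
  let ?B = "cbox p q"
  have int: "integrable lborel (\<lambda>x. indicator ?B x * u x)"
    using u by (auto simp: locally_integrable_def set_integrable_def)
  have meas [measurable]: "(\<lambda>x. indicator ?B x * u x) \<in> borel_measurable borel"
    using int by auto
  have bump_meas [measurable]: "box_bump (real (Suc n)) p q \<in> borel_measurable borel" for n
    by (rule test_functions_measurable[OF box_bump_in_test_functions[of _ p q UNIV]]) auto
  have in_cbox: "u x * box_bump (real (Suc n)) p q x = (indicator ?B x * u x) * box_bump (real (Suc n)) p q x" for n x
    using box_bump_eq_0[of "real (Suc n)" x p q] box_subset_cbox[of p q] by (auto simp: indicator_def)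
  have in_cbox': "u x * indicator (box p q) x = (indicator ?B x * u x) * indicator (box p q) x" for x
    using box_subset_cbox[of p q] by (auto simp: indicator_def)
  show ?thesis
    unfolding in_cbox in_cbox'
  proof (rule integral_dominated_convergence[where w = "\<lambda>x. \<bar>indicator ?B x * u x\<bar>"])
    show "AE x in lborel. (\<lambda>n. (indicator ?B x * u x) * box_bump (real (Suc n)) p q x)
        \<longlonglongrightarrow> (indicator ?B x * u x) * indicator (box p q) x"
      by (intro AE_I2 tendsto_mult tendsto_const box_bump_tendsto_indicator)
    show "AE x in lborel. norm ((indicator ?B x * u x) * box_bump (real (Suc n)) p q x) \<le> \<bar>indicator ?B x * u x\<bar>" for n
      by (intro AE_I2) (simp add: abs_mult box_bump_bounds mult_left_le)
    show "(\<lambda>x. (indicator ?B x * u x) * box_bump (real (Suc n)) p q x) \<in> borel_measurable lborel" for n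
      using borel_measurable_times[OF meas bump_meas[of n]] by (simp del: of_nat_Suc)
    show "(\<lambda>x. (indicator ?B x * u x) * indicator (box p q) x) \<in> borel_measurable lborel"
      using borel_measurable_times[OF meas borel_measurable_indicator[of "box p q"]] by simp
  qed (use int in \<open>auto intro: integrable_abs\<close>)
qed

lemma dist_of_fun_eq_imp_box_integral_eq:
  assumes "locally_integrable u" "locally_integrable u'" "dist_of_fun u = dist_of_fun u'"
  shows "(LINT x|lborel. u x * indicator (box p q) x) = (LINT x|lborel. u' x * indicator (box p q) x)"
proof -
  have "(LINT x|lborel. u x * box_bump (real (Suc n)) p q x) = (LINT x|lborel. u' x * box_bump (real (Suc n)) p q x)" for n
    using fun_cong[OF assms(3), of "box_bump (real (Suc n)) p q"]
      box_bump_in_test_functions[of "real (Suc n)" p q UNIV] by (simp add: dist_of_fun_def)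
  then show ?thesis
    using locally_integrable_box_bump_tendsto[OF assms(1), of p q]
      locally_integrable_box_bump_tendsto[OF assms(2), of p q] LIMSEQ_unique by auto
qed

lemma AE_lborel_box_cbox: "AE x in lborel. x \<in> box p q \<longleftrightarrow> x \<in> cbox p (q :: plane)"
proof -
  have "negligible (cbox p q - box p q)"
    by (rule negligible_frontier_interval)
  then have "cbox p q - box p q \<in> null_sets lborel"
    by (auto simp: negligible_iff_null_sets null_sets_completion_iff)
  then have "AE x in lborel. x \<notin> cbox p q - box p q"
    by (rule AE_not_in)
  then show ?thesis
    by eventually_elim (use box_subset_cbox[of p q] in auto)
qed

lemma integral_cbox_eq_box:
  assumes u: "locally_integrable u"
  shows "(LINT x|lborel. u x * indicator (cbox p q) x) = (LINT x|lborel. u x * indicator (box p q) x)"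
proof (rule integral_cong_AE)
  have "integrable lborel (\<lambda>x. indicator (cbox p q) x * u x)"
    using u by (auto simp: locally_integrable_def set_integrable_def)
  then have cbox: "(\<lambda>x. u x * indicator (cbox p q) x) \<in> borel_measurable lborel"
    by (simp add: mult.commute borel_measurable_integrable)
  then show "(\<lambda>x. u x * indicator (cbox p q) x) \<in> borel_measurable lborel" .
  have "(\<lambda>x. u x * indicator (box p q) x) = (\<lambda>x. (u x * indicator (cbox p q) x) * indicator (box p q) x)"
    by (rule ext) (use box_subset_cbox[of p q] in \<open>auto simp: indicator_def\<close>)
  then show "(\<lambda>x. u x * indicator (box p q) x) \<in> borel_measurable lborel"
    using cbox by simp
  show "AE x in lborel. u x * indicator (cbox p q) x = u x * indicator (box p q) x"
    using AE_lborel_box_cbox[of p q] by eventually_elim (simp add: indicator_def)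
qed

lemma open_pixel_disjoint:
  assumes "x \<in> box (knot n k) (knot n (k + (1, 1)))" "x \<in> pixel n l"
  shows "l = k"
proof -
  have "i = j" if "real_of_int (i - 1) / 2 ^ n < s" "s < real_of_int i / 2 ^ n"
    "real_of_int (j - 1) / 2 ^ n \<le> s" "s \<le> real_of_int j / 2 ^ n" for i j s
  proof -
    have "real_of_int (i - 1) / 2 ^ n < real_of_int j / 2 ^ n" "real_of_int (j - 1) / 2 ^ n < real_of_int i / 2 ^ n"
      using that by linarith+
    then have "real_of_int (i - 1) < real_of_int j" "real_of_int (j - 1) < real_of_int i"
      by (auto simp: divide_less_cancel)
    then show ?thesis by linarith
  qed
  from this[of "fst k" "fst x" "fst l"] this[of "snd k" "snd x" "snd l"] show ?thesis
    using assms unfolding mem_box_plane by (auto simp: pixel_def knot_def prod_eq_iff)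
qed

text \<open>
  The pairing is with an arbitrary locally integrable representative of the image. On a pixel its
  integral is that of the step function, which is constant on the open pixel, as this meets no other
  pixel; the boundary is a null set.
\<close>

lemma T_op_T_star:
  assumes a: "a \<in> nonneg_matrices n"
  shows "T_op n (T_star n a) = a"
proof
  fix k
  define u where "u x = (\<Sum>k\<in>indices n. a k * indicator (pixel n k) x)" for x :: plane
  define u' where "u' = fun_of_dist (T_star n a)"
  have "locally_integrable u"
    unfolding locally_integrable_def
  proof (intro allI impI)
    fix L :: "plane set" assume L: "compact L"
    have "set_integrable lborel L (\<lambda>x. a k * indicator (pixel n k) x)" for k
    proof -
      have "compact (L \<inter> pixel n k)"
        unfolding pixel_eq_cbox by (intro compact_Int_closed L closed_cbox)
      then have "integrable lborel (indicator (L \<inter> pixel n k) :: plane \<Rightarrow> real)"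
        using emeasure_compact_finite by (intro integrable_real_indicator) (auto intro: borel_compact)
      then have "integrable lborel (\<lambda>x. a k * indicator (L \<inter> pixel n k) x)"
        by (rule integrable_mult_right)
      then show ?thesis
        by (simp add: set_integrable_def indicator_inter_arith mult.left_commute)
    qed
    then show "set_integrable lborel L u"
      unfolding u_def set_integrable_def scaleR_sum_right by (intro Bochner_Integration.integrable_sum)
  qed
  moreover have "dist_of_fun u = T_star n a"
    by (simp add: T_star_def u_def[abs_def])
  ultimately have u: "locally_integrable u \<and> dist_of_fun u = T_star n a" by simp
  then have u': "locally_integrable u'" "dist_of_fun u' = T_star n a"
    using someI[of "\<lambda>u. locally_integrable u \<and> dist_of_fun u = T_star n a" u]
    by (simp_all add: u'_def fun_of_dist_def)
  show "T_op n (T_star n a) k = a k"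
  proof (cases "k \<in> indices n")
    case True
    let ?p = "knot n k" and ?q = "knot n (k + (1, 1))"
    have "pairing (T_star n a) (indicator (pixel n k)) = (LINT x|lborel. u' x * indicator (cbox ?p ?q) x)"
      by (simp add: pairing_def u'_def pixel_eq_cbox)
    also have "\<dots> = (LINT x|lborel. u' x * indicator (box ?p ?q) x)"
      by (rule integral_cbox_eq_box[OF u'(1)])
    also have "\<dots> = (LINT x|lborel. u x * indicator (box ?p ?q) x)"
      using u u' by (intro dist_of_fun_eq_imp_box_integral_eq) auto
    also have "\<dots> = (LINT x|lborel. a k * indicator (box ?p ?q) x)"
    proof (rule Bochner_Integration.integral_cong)
      fix x
      show "u x * indicator (box ?p ?q) x = a k * indicator (box ?p ?q) x"
      proof (cases "x \<in> box ?p ?q")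
        case inside: True
        then have "x \<in> pixel n k"
          using box_subset_cbox by (auto simp: pixel_eq_cbox)
        moreover have "x \<notin> pixel n l" if "l \<noteq> k" for l
          using open_pixel_disjoint[OF inside] that by blast
        ultimately have "indicator (pixel n l) x = (if k = l then 1 else 0 :: real)" for l
          by (cases "k = l") auto
        then have "u x = (\<Sum>l\<in>indices n. if k = l then a l else 0)"
          unfolding u_def by (intro sum.cong) auto
        then show ?thesis
          using True by simp
      qed simp
    qed simp
    also have "\<dots> = a k * (1 / 2 ^ n * (1 / 2 ^ n))"
    proof -
      have "measure lborel (box ?p ?q) = (1 / 2 ^ n) * (1 / 2 ^ n)"
        by (subst measure_lborel_box)
           (auto simp: knot_def Basis_prod_def prod.union_disjoint divide_right_mono inner_prod_def diff_divide_distrib[symmetric])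
      then show ?thesis by simp
    qed
    finally show ?thesis
      using True by (simp add: T_op_def mult_2 power_add)
  next
    case False
    then show ?thesis
      using nonneg_matrices_outside[OF a] by (simp add: T_op_def)
  qed
qed

theorem proposition7:
  fixes E :: "real ^ 'm \<Rightarrow> real ^ 'm \<Rightarrow> ennreal"
    and y :: "real ^ 'm"
    and \<nu> :: "functional \<Rightarrow> real ^ 'm"
    and n :: nat
    and \<theta> lam :: real
    and f :: functional
  assumes "\<And>z. proper (E z)"
    and "\<And>z. coercive (E z)"
    and "\<And>z. continuous_on UNIV (E z)"
    and "\<And>z. strictly_convex (E z)"
    and "linear_on_cone \<nu>"
    and "weak_star_continuous \<nu>"
    and "0 < \<theta>" and "\<theta> \<le> 1"
    and "lam > 0"
    and "f \<in> M_DD0_pos_grid n"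
  shows "f \<in> V_grid E y \<nu> \<theta> lam n \<longleftrightarrow> T_op n f \<in> V_tilde E y \<nu> \<theta> lam n"
proof -
  let ?F = "\<lambda>f. E y (\<nu> f) + ennreal lam * theta_norm \<theta> f"
  let ?G = "\<lambda>a. E y (\<nu> (T_star n a)) + ennreal (lam * discrete_theta_norm n \<theta> a)"
  have FG: "?F (T_star n a) = ?G a" if "a \<in> nonneg_matrices n" for a
    using theta_norm_T_star[OF nonneg_matrices_outside[OF that], where \<theta> = \<theta>] \<open>0 < \<theta>\<close> \<open>\<theta> \<le> 1\<close> \<open>lam > 0\<close>
    by (simp add: ennreal_mult')
  have surj: "M_DD0_pos_grid n = T_star n ` nonneg_matrices n"
    using grid_space_is_T_star T_star_in_grid_space by (metis (no_types, lifting) image_iff subsetI subset_antisym)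
  obtain a where a: "a \<in> nonneg_matrices n" "f = T_star n a"
    using grid_space_is_T_star[OF \<open>f \<in> M_DD0_pos_grid n\<close>] .
  have less: "?F (T_star n b) < ?F (T_star n a) \<longleftrightarrow> ?G b < ?G a" if "b \<in> nonneg_matrices n" for b
    by (simp only: FG[OF that] FG[OF a(1)])
  from a have "T_op n f = a"
    by (simp add: T_op_T_star)
  then show ?thesis
    using a less by (auto simp: V_grid_def V_tilde_def argmin_set_def is_arg_min_def surj)
qed

end
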